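(* Let $n\ge1$, $p\in[1,\infty)$, $\theta\in[1,\infty]$, $\alpha\in(0,1)$. For every function $f\in L^p(\mathbb{R}^n)$ the following conditions are equivalent: (i) $f\in B^\alpha_{p,\theta}(\mathbb{R}^n)$; (ii) $V^{p,\theta,\alpha}(f)<\infty$; (iii) $\widetilde V^{p,\theta,\alpha}(f)<\infty$. Moreover, $$ 2^{\alpha-1}\|f\|_{\alpha,p,\theta}\le \widetilde V^{p,\theta,\alpha}(f)\le V^{p,\theta,\alpha}(f)\le 2(1+\sqrt n+n)\|f\|_{\alpha,p,\theta}. $$
   Context: Functions are real-valued; $L^p$-norms $\|\cdot\|_p$ are with respect to Lebesgue measure on $\mathbb{R}^n$, $|\cdot|$ is the Euclidean norm, $q=p/(p-1)$ ($q=\infty$ if $p=1$). $C_0^\infty$ denotes infinitely differentiable compactly supported functions (or vector fields); $\|\Phi\|_q$ is the $L^q$-norm of $|\Phi|$. With $f_h(x):=f(x-h)$, for $\varepsilon>0$ set $$\omega_p(f,\varepsilon):=\sup_{|h|\le\varepsilon}\|f_h-f\|_p,$$ $$\sigma_p(f,\varepsilon):=\sup\Bigl\{\int_{\mathbb{R}^n}\mathrm{div}\,\Phi\, f\,dx:\ \Phi\in C_0^\infty(\mathbb{R}^n,\mathbb{R}^n),\ \|\mathrm{div}\,\Phi\|_q\le 1,\ \|\Phi\|_q\le\varepsilon\Bigr\},$$ $$\widetilde\sigma_p(f,\varepsilon):=\sup\Bigl\{\int_{\mathbb{R}^n}\partial_e\varphi\, f\,dx:\ e\in\mathbb{R}^n,\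 |e|=1,\ \varphi\in C_0^\infty(\mathbb{R}^n),\ \|\partial_e\varphi\|_q\le 1,\ \|\varphi\|_q\le\varepsilon\Bigr\}.$$ Further, $$\|f\|_{\alpha,p,\theta}:=\Bigl(\int_0^\infty[s^{-\alpha}\omega_p(f,s)]^\theta s^{-1}ds\Bigr)^{1/\theta},\quad V^{p,\theta,\alpha}(f):=\Bigl(\int_0^\infty[s^{-\alpha}\sigma_p(f,s)]^\theta s^{-1}ds\Bigr)^{1/\theta},$$ $$\widetilde V^{p,\theta,\alpha}(f):=\Bigl(\int_0^\infty[s^{-\alpha}\widetilde\sigma_p(f,s)]^\theta s^{-1}ds\Bigr)^{1/\theta},$$ where for $\theta=\infty$ these expressions mean the supremum over $s>0$ of the bracketed quantity; values in $[0,\infty]$ are allowed. The Besov class $B^\alpha_{p,\theta}(\mathbb{R}^n)$ consists of all $f\in L^p(\mathbb{R}^n)$ with $\|f\|_{\alpha,p,\theta}<\infty$. *)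

theory Defs
  imports "HOL-Analysis.Analysis" "HOL-Probability.Essential_Supremum"
begin

(* Real powers on [0,\<infinity>]. Only meant for exponents a > 0, so that the value at \<infinity> is \<infinity>. *)
definition epowr :: "ennreal \<Rightarrow> real \<Rightarrow> ennreal" where
  "epowr x a = (if x = top then top else ennreal (enn2real x powr a))"

definition Lp_norm :: "ennreal \<Rightarrow> ('a::euclidean_space \<Rightarrow> 'b::real_normed_vector) \<Rightarrow> ennreal" where
  "Lp_norm p f =
     (if p = top then esssup lebesgue (\<lambda>x. ennreal (norm (f x)))
      else epowr (\<integral>\<^sup>+x. ennreal (norm (f x) powr enn2real p) \<partial>lebesgue) (1 / enn2real p))"

(* Functions, not classes modulo null sets. *)
definition Lp_space :: "ennreal \<Rightarrow> ('a::euclidean_space \<Rightarrow> real) set" where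
  "Lp_space p = {f. f \<in> borel_measurable lebesgue \<and> Lp_norm p f < top}"

definition conj_exponent :: "real \<Rightarrow> ennreal" where
  "conj_exponent p = (if p = 1 then top else ennreal (p / (p - 1)))"

definition dir_deriv ::
  "'a::real_normed_vector \<Rightarrow> ('a \<Rightarrow> 'b::real_normed_vector) \<Rightarrow> 'a \<Rightarrow> 'b" where
  "dir_deriv e \<phi> x = frechet_derivative \<phi> (at x) e"

fun Ck :: "nat \<Rightarrow> ('a::euclidean_space \<Rightarrow> 'b::real_normed_vector) \<Rightarrow> bool" where
  "Ck 0 f \<longleftrightarrow> continuous_on UNIV f"
| "Ck (Suc k) f \<longleftrightarrow> (\<forall>x. f differentiable (at x)) \<and> (\<forall>v. Ck k (dir_deriv v f))"

definition test_functions :: "('a::euclidean_space \<Rightarrow> 'b::real_normed_vector) set" where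
  "test_functions = {f. (\<forall>k. Ck k f) \<and> compact (closure {x. f x \<noteq> 0})}"

definition divergence :: "(real^'n \<Rightarrow> real^'n) \<Rightarrow> real^'n \<Rightarrow> real" where
  "divergence \<Phi> x = (\<Sum>i\<in>UNIV. dir_deriv (axis i 1) (\<lambda>y. \<Phi> y $ i) x)"

definition omega_p :: "real \<Rightarrow> (real^'n \<Rightarrow> real) \<Rightarrow> real \<Rightarrow> ennreal" where
  "omega_p p f \<epsilon> = (SUP h\<in>{h. norm h \<le> \<epsilon>}. Lp_norm (ennreal p) (\<lambda>x. f (x - h) - f x))"

(* In sigma_p and sigma_tilde_p, ennreal sends negative integrals to 0. This does not change the
   supremum: for \<epsilon> > 0 the zero field (function) is admissible and gives the value 0. *)
definition sigma_p :: "real \<Rightarrow> (real^'n \<Rightarrow> real) \<Rightarrow> real \<Rightarrow> ennreal" where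
  "sigma_p p f \<epsilon> =
     (SUP \<Phi>\<in>{\<Phi>. \<Phi> \<in> test_functions
                 \<and> Lp_norm (conj_exponent p) (divergence \<Phi>) \<le> 1
                 \<and> Lp_norm (conj_exponent p) \<Phi> \<le> ennreal \<epsilon>}.
        ennreal (\<integral>x. divergence \<Phi> x * f x \<partial>lebesgue))"

definition sigma_tilde_p :: "real \<Rightarrow> (real^'n \<Rightarrow> real) \<Rightarrow> real \<Rightarrow> ennreal" where
  "sigma_tilde_p p f \<epsilon> =
     (SUP (e, \<phi>)\<in>{(e, \<phi>). norm e = 1 \<and> \<phi> \<in> test_functions
                 \<and> Lp_norm (conj_exponent p) (dir_deriv e \<phi>) \<le> 1
                 \<and> Lp_norm (conj_exponent p) \<phi> \<le> ennreal \<epsilon>}.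
        ennreal (\<integral>x. dir_deriv e \<phi> x * f x \<partial>lebesgue))"

(* The L^\<theta>(ds/s)-norm of s^(-\<alpha>) g(s) over (0,\<infinity>), common to the three functionals below. *)
definition weighted_norm :: "real \<Rightarrow> ennreal \<Rightarrow> (real \<Rightarrow> ennreal) \<Rightarrow> ennreal" where
  "weighted_norm \<alpha> \<theta> g =
     (if \<theta> = top then (SUP s\<in>{0<..}. ennreal (s powr (-\<alpha>)) * g s)
      else epowr (\<integral>\<^sup>+s\<in>{0<..}. epowr (ennreal (s powr (-\<alpha>)) * g s) (enn2real \<theta>)
                                 * ennreal (1 / s) \<partial>lebesgue) (1 / enn2real \<theta>))"

definition besov_seminorm :: "real \<Rightarrow> real \<Rightarrow> ennreal \<Rightarrow> (real^'n \<Rightarrow> real) \<Rightarrow> ennreal" where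
  "besov_seminorm \<alpha> p \<theta> f = weighted_norm \<alpha> \<theta> (omega_p p f)"

definition V_functional :: "real \<Rightarrow> ennreal \<Rightarrow> real \<Rightarrow> (real^'n \<Rightarrow> real) \<Rightarrow> ennreal" where
  "V_functional p \<theta> \<alpha> f = weighted_norm \<alpha> \<theta> (sigma_p p f)"

definition V_tilde_functional :: "real \<Rightarrow> ennreal \<Rightarrow> real \<Rightarrow> (real^'n \<Rightarrow> real) \<Rightarrow> ennreal" where
  "V_tilde_functional p \<theta> \<alpha> f = weighted_norm \<alpha> \<theta> (sigma_tilde_p p f)"

definition besov_class :: "real \<Rightarrow> real \<Rightarrow> ennreal \<Rightarrow> (real^'n \<Rightarrow> real) set" where
  "besov_class \<alpha> p \<theta> = {f \<in> Lp_space (ennreal p). besov_seminorm \<alpha> p \<theta> f < top}"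

end

theory Submission
  imports Defs
begin

text \<open>
  Write \<open>\<omega>\<close>, \<open>\<sigma>\<close> and \<open>\<sigma>'\<close> for \<^const>\<open>omega_p\<close>, \<^const>\<open>sigma_p\<close> and \<^const>\<open>sigma_tilde_p\<close> of
  a fixed \<open>f\<close> in \<open>L\<^sup>p\<close>, and \<open>q\<close> for the conjugate exponent of \<open>p\<close>. The three weighted norms are
  comparable because the three moduli are comparable for every \<open>\<epsilon> > 0\<close>:
  \<open>\<omega>(2 \<epsilon>) \<le> 2 \<sigma>'(\<epsilon>)\<close>, \<open>\<sigma>'(\<epsilon>) \<le> \<sigma>(\<epsilon>)\<close> and \<open>\<sigma>(\<epsilon>) \<le> 2 n \<omega>(\<epsilon>)\<close>. The substitution
  \<open>s \<mapsto> s / 2\<close> turns the factor 2 of the first inequality into \<open>2\<^sup>1\<^sup>-\<^sup>\<alpha>\<close>, and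
  \<open>2 n \<le> 2 (1 + \<surd>n + n)\<close>.

  All three rest on one operator, the average \<open>A\<^sub>v g(x)\<close> of \<open>g(x + t v)\<close> over \<open>0 \<le> t \<le> 1\<close>
  (\<open>line_avg\<close>). It is a contraction in \<open>L\<^sup>q\<close>, preserves test functions, commutes with the other
  averages and with translations, and satisfies \<open>A\<^sub>v (\<partial>\<^sub>v g)(x) = g(x + v) - g(x)\<close>.

  For the first inequality (\<open>omega_p_le_sigma_tilde_p\<close>), let \<open>h = \<bar>h\<bar> e\<close> with \<open>\<bar>h\<bar> \<le> 2 \<epsilon>\<close> and let
  \<open>\<psi>\<close> be a test function with \<open>\<parallel>\<psi>\<parallel>\<^sub>q \<le> 1\<close>. Then \<open>\<phi> = (\<bar>h\<bar> / 2) A\<^sub>h \<psi>\<close> satisfies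
  \<open>\<partial>\<^sub>e \<phi> = (\<psi>(\<sqdot> + h) - \<psi>) / 2\<close>, hence is admissible for \<open>\<sigma>'(\<epsilon>)\<close>, and pairing it with \<open>f\<close>
  gives half the pairing of \<open>\<psi>\<close> with \<open>f\<^sub>h - f\<close>. The supremum over \<open>\<psi>\<close> is \<open>\<parallel>f\<^sub>h - f\<parallel>\<^sub>p\<close> by duality
  (\<open>Lp_norm_le_dual\<close>). The second inequality is the choice \<open>\<Phi> = \<phi> e\<close>.

  For the third (\<open>sigma_p_le_omega_p\<close>), let \<open>A\<close> be the composition of the averages along the \<open>n\<close>
  vectors \<open>\<epsilon> e\<^sub>i\<close>. Replacing \<open>div \<Phi>\<close> by \<open>A (div \<Phi>)\<close> one average at a time changes its pairing
  with \<open>f\<close> by at most \<open>n \<omega>(\<epsilon>) \<parallel>div \<Phi>\<parallel>\<^sub>q\<close>. In the pairing of \<open>f\<close> with \<open>A (\<partial>\<^sub>i \<Phi>\<^sub>i)\<close> the average along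
  \<open>\<epsilon> e\<^sub>i\<close> turns the derivative into \<open>1 / \<epsilon>\<close> times a difference, which is moved to \<open>f\<close>; so each of
  these \<open>n\<close> terms is at most \<open>\<omega>(\<epsilon>) \<parallel>\<Phi>\<^sub>i\<parallel>\<^sub>q / \<epsilon> \<le> \<omega>(\<epsilon>)\<close>.
\<close>

section \<open>Functions with continuous derivatives up to a given order\<close>

lemma dir_deriv_eq: "(f has_derivative f') (at x) \<Longrightarrow> dir_deriv v f x = f' v"
  unfolding dir_deriv_def using frechet_derivative_at by metis

lemma Ck_SucI:
  assumes "\<And>x. (f has_derivative D x) (at x)" and "\<And>v. Ck k (\<lambda>x. D x v)"
  shows "Ck (Suc k) f"
proof -
  have "dir_deriv v f = (\<lambda>x. D x v)" for v
    using dir_deriv_eq[OF assms(1)] by auto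
  then show ?thesis
    using assms by (auto simp: differentiable_def)
qed

lemma Ck_SucD:
  assumes "Ck (Suc k) f"
  shows "(f has_derivative (\<lambda>v. dir_deriv v f x)) (at x)" and "Ck k (dir_deriv v f)"
  using assms by (auto simp: dir_deriv_def frechet_derivative_works)

lemma Ck_pred: "Ck (Suc k) f \<Longrightarrow> Ck k f"
proof (induction k arbitrary: f)
  case 0
  have "isCont f x" for x
    using Ck_SucD(1)[OF 0] has_derivative_continuous by blast
  then show ?case
    by (simp add: continuous_at_imp_continuous_on)
next
  case (Suc k)
  then show ?case
    by (metis Ck.simps(2))
qed

lemma Ck_continuous: "Ck k f \<Longrightarrow> continuous_on UNIV f"
  by (induction k) (auto dest: Ck_pred simp del: Ck.simps(2))

lemma Ck_const: "Ck k (\<lambda>x. c)"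
proof (induction k arbitrary: c)
  case (Suc k)
  show ?case
    by (rule Ck_SucI[where D="\<lambda>_ _. 0"]) (auto intro: Suc)
qed auto

lemma Ck_bounded_linear_compose:
  assumes "bounded_linear L" "Ck k f"
  shows "Ck k (\<lambda>x. L (f x))"
  using assms(2)
proof (induction k arbitrary: f)
  case 0
  then show ?case
    using bounded_linear.continuous_on[OF assms(1)] by auto
next
  case (Suc k)
  show ?case
  proof (rule Ck_SucI)
    show "((\<lambda>x. L (f x)) has_derivative (\<lambda>v. L (dir_deriv v f x))) (at x)" for x
      by (rule bounded_linear.has_derivative[OF assms(1) Ck_SucD(1)[OF Suc.prems]])
    show "Ck k (\<lambda>x. L (dir_deriv v f x))" for v
      by (rule Suc.IH[OF Ck_SucD(2)[OF Suc.prems]])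
  qed
qed

lemma Ck_bounded_linear:
  assumes "bounded_linear f"
  shows "Ck k f"
proof (cases k)
  case 0
  then show ?thesis
    using bounded_linear.continuous_on[OF assms continuous_on_id] by auto
next
  case (Suc m)
  have "Ck (Suc m) f"
    by (rule Ck_SucI[OF bounded_linear_imp_has_derivative[OF assms]]) (rule Ck_const)
  with Suc show ?thesis by simp
qed

lemma Ck_add: "Ck k f \<Longrightarrow> Ck k g \<Longrightarrow> Ck k (\<lambda>x. f x + g x)"
proof (induction k arbitrary: f g)
  case 0
  then show ?case by (auto intro: continuous_intros)
next
  case (Suc k)
  show ?case
  proof (rule Ck_SucI)
    show "((\<lambda>x. f x + g x) has_derivative (\<lambda>v. dir_deriv v f x + dir_deriv v g x)) (at x)" for x
      by (intro has_derivative_add Ck_SucD(1)[OF Suc.prems(1)] Ck_SucD(1)[OF Suc.prems(2)])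
    show "Ck k (\<lambda>x. dir_deriv v f x + dir_deriv v g x)" for v
      by (intro Suc.IH Ck_SucD(2)[OF Suc.prems(1)] Ck_SucD(2)[OF Suc.prems(2)])
  qed
qed

lemma Ck_mult:
  fixes f g :: "'a::euclidean_space \<Rightarrow> real"
  shows "Ck k f \<Longrightarrow> Ck k g \<Longrightarrow> Ck k (\<lambda>x. f x * g x)"
proof (induction k arbitrary: f g)
  case 0
  then show ?case by (auto intro: continuous_intros)
next
  case (Suc k)
  show ?case
  proof (rule Ck_SucI)
    show "((\<lambda>x. f x * g x) has_derivative
        (\<lambda>v. f x * dir_deriv v g x + dir_deriv v f x * g x)) (at x)" for x
      by (intro has_derivative_mult Ck_SucD(1)[OF Suc.prems(1)] Ck_SucD(1)[OF Suc.prems(2)])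
    show "Ck k (\<lambda>x. f x * dir_deriv v g x + dir_deriv v f x * g x)" for v
      using Suc.prems Ck_SucD(2) by (intro Ck_add Suc.IH) (auto intro: Ck_pred simp del: Ck.simps)
  qed
qed

lemma Ck_real_polynomial:
  fixes P :: "'a::euclidean_space \<Rightarrow> real"
  assumes "real_polynomial_function P"
  shows "Ck k P"
  using assms by induction (auto intro: Ck_bounded_linear Ck_const Ck_add Ck_mult)

section \<open>Smooth cut-off functions\<close>

text \<open>The functions \<open>t\<^sup>-\<^sup>m e\<^sup>-\<^sup>1\<^sup>/\<^sup>t\<close> on the positive half-line, extended by zero. Their linear span
  is closed under differentiation, so all of them are smooth.\<close>

definition flat_exp :: "nat \<Rightarrow> real \<Rightarrow> real" where
  "flat_exp m t = (if t > 0 then exp (-1 / t) / t ^ m else 0)"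

lemma flat_exp_tendsto_0: "(flat_exp m \<longlongrightarrow> 0) (at 0)"
proof -
  have "((\<lambda>t. inverse t ^ m / exp (inverse t)) \<longlongrightarrow> (0::real)) (at_right 0)"
    by (rule filterlim_compose[OF tendsto_power_div_exp_0 filterlim_inverse_at_top_right])
  moreover have "eventually (\<lambda>t::real. inverse t ^ m / exp (inverse t) = flat_exp m t) (at_right 0)"
    by (rule eventually_at_rightI[of 0 1])
      (auto simp: flat_exp_def exp_minus divide_simps power_inverse)
  ultimately have right: "(flat_exp m \<longlongrightarrow> 0) (at_right 0)"
    by (rule Lim_transform_eventually)
  have "eventually (\<lambda>t. 0 = flat_exp m t) (at_left 0)"
    by (rule eventually_at_leftI[of "-1"]) (auto simp: flat_exp_def)
  then have "(flat_exp m \<longlongrightarrow> 0) (at_left 0)"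
    by (rule Lim_transform_eventually[OF tendsto_const])
  with right show ?thesis
    by (simp add: filterlim_split_at)
qed

lemma flat_exp_has_derivative:
  "(flat_exp m has_real_derivative flat_exp (m + 2) t - real m * flat_exp (m + 1) t) (at t)"
proof (cases t "0::real" rule: linorder_cases)
  case less
  have "((\<lambda>_. 0) has_real_derivative 0) (at t)"
    by simp
  then have "(flat_exp m has_real_derivative 0) (at t)"
    by (rule has_field_derivative_transform_within_open[where S="{..<0}"])
      (use less in \<open>auto simp: flat_exp_def\<close>)
  with less show ?thesis by (simp add: flat_exp_def)
next
  case equal
  have "((\<lambda>h. (flat_exp m (0 + h) - flat_exp m 0) / h) \<longlongrightarrow> 0) (at 0)"
  proof (rule Lim_transform_eventually[OF flat_exp_tendsto_0[of "Suc m"]])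
    show "eventually (\<lambda>h. flat_exp (Suc m) h = (flat_exp m (0 + h) - flat_exp m 0) / h) (at 0)"
      by (auto simp: flat_exp_def eventually_at_filter)
  qed
  then have "(flat_exp m has_real_derivative 0) (at 0)"
    by (simp add: DERIV_def)
  with equal show ?thesis by (simp add: flat_exp_def)
next
  case greater
  have "((\<lambda>t. exp (-1 / t) / t ^ m) has_real_derivative
      ((exp (-1 / t) * (1 / t\<^sup>2)) * t ^ m - exp (-1 / t) * (real m * t ^ (m - 1))) / (t ^ m * t ^ m)) (at t)"
    using greater by (auto intro!: derivative_eq_intros simp: power2_eq_square)
  moreover have "((exp (-1 / t) * (1 / t\<^sup>2)) * t ^ m - exp (-1 / t) * (real m * t ^ (m - 1)))
      / (t ^ m * t ^ m) = flat_exp (m + 2) t - real m * flat_exp (m + 1) t"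
  proof (cases m)
    case (Suc j)
    then show ?thesis
      using greater by (simp add: flat_exp_def divide_simps power2_eq_square) (simp add: algebra_simps)
  qed (use greater in \<open>simp add: flat_exp_def power2_eq_square\<close>)
  ultimately have "((\<lambda>t. exp (-1 / t) / t ^ m) has_real_derivative
      flat_exp (m + 2) t - real m * flat_exp (m + 1) t) (at t)"
    by simp
  then show ?thesis
    by (rule has_field_derivative_transform_within_open[where S="{0<..}"])
      (use greater in \<open>auto simp: flat_exp_def\<close>)
qed

lemma flat_exp_mono: "s \<le> t \<Longrightarrow> flat_exp 0 s \<le> flat_exp 0 t"
  by (auto simp: flat_exp_def divide_simps)

lemma Ck_flat_exp_compose:
  fixes u :: "'a::euclidean_space \<Rightarrow> real"
  assumes "\<And>k. Ck k u"
  shows "Ck k (\<lambda>x. flat_exp m (u x))"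
proof (induction k arbitrary: m)
  case 0
  have "continuous_on UNIV (flat_exp m)"
    by (rule DERIV_continuous_on) (blast intro: flat_exp_has_derivative DERIV_subset)
  moreover have "continuous_on UNIV u"
    using assms[of 0] by simp
  ultimately have "continuous_on UNIV (flat_exp m \<circ> u)"
    using continuous_on_compose continuous_on_subset subset_UNIV by blast
  then show ?case by (simp add: o_def)
next
  case (Suc k)
  show ?case
  proof (rule Ck_SucI)
    show "((\<lambda>x. flat_exp m (u x)) has_derivative (\<lambda>v. (flat_exp (m + 2) (u x)
        + (- real m) * flat_exp (m + 1) (u x)) * dir_deriv v u x)) (at x)" for x
      using has_derivative_compose[OF Ck_SucD(1)[OF assms]
          has_field_derivative_imp_has_derivative[OF flat_exp_has_derivative]]
      by simp
    show "Ck k (\<lambda>x. (flat_exp (m + 2) (u x)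
        + (- real m) * flat_exp (m + 1) (u x)) * dir_deriv v u x)" for v
      by (intro Ck_mult Ck_add Suc.IH Ck_const Ck_SucD(2)[OF assms])
  qed
qed

text \<open>A radial cut-off function, positive on the open ball of radius \<open>R\<close> and zero outside.\<close>

definition bump :: "real \<Rightarrow> 'a::euclidean_space \<Rightarrow> real" where
  "bump R x = flat_exp 0 (R\<^sup>2 - x \<bullet> x)"

lemma Ck_bump: "Ck k (bump R)"
proof -
  have "Ck k (\<lambda>x::'a. R\<^sup>2 - x \<bullet> x)" for k
  proof (rule Ck_pred, rule Ck_SucI)
    show "((\<lambda>x. R\<^sup>2 - x \<bullet> x) has_derivative (\<lambda>h. - 2 * (x \<bullet> h))) (at x)" for x :: 'a
      by (auto intro!: derivative_eq_intros simp: inner_commute)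
    show "Ck k (\<lambda>x::'a. - 2 * (x \<bullet> v))" for v
      by (rule Ck_bounded_linear)
        (intro bounded_linear_const_mult bounded_linear_inner_left)
  qed
  then show ?thesis
    unfolding bump_def by (rule Ck_flat_exp_compose)
qed

lemma bump_nonneg: "0 \<le> bump R x"
  by (simp add: bump_def flat_exp_def)

lemma bump_le_1: "bump R x \<le> 1"
  by (simp add: bump_def flat_exp_def)

lemma bump_outside: "0 \<le> R \<Longrightarrow> R \<le> norm x \<Longrightarrow> bump R x = 0"
  by (simp add: bump_def flat_exp_def dot_square_norm not_less power_mono)

text \<open>On the ball of radius \<open>r < R\<close> the cut-off is bounded below by a positive constant.\<close>

lemma bump_lower_bound:
  assumes "norm x \<le> r" "r < R"
  shows "0 < flat_exp 0 (R\<^sup>2 - r\<^sup>2)" and "flat_exp 0 (R\<^sup>2 - r\<^sup>2) \<le> bump R x"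
proof -
  have "0 \<le> r" using norm_ge_zero assms(1) by (rule order_trans)
  with assms show "0 < flat_exp 0 (R\<^sup>2 - r\<^sup>2)"
    by (auto simp: flat_exp_def power_strict_mono)
  show "flat_exp 0 (R\<^sup>2 - r\<^sup>2) \<le> bump R x"
    unfolding bump_def dot_square_norm using assms
    by (intro flat_exp_mono) (simp add: power_mono)
qed

section \<open>Test functions\<close>

lemma test_functions_iff:
  "f \<in> test_functions \<longleftrightarrow> (\<forall>k. Ck k f) \<and> (\<exists>R. \<forall>x. R \<le> norm x \<longrightarrow> f x = 0)"
proof -
  have "bounded {x. f x \<noteq> 0} \<longleftrightarrow> (\<exists>R. \<forall>x. R \<le> norm x \<longrightarrow> f x = 0)"
  proof
    assume "bounded {x. f x \<noteq> 0}"
    then obtain B where "\<And>x. f x \<noteq> 0 \<Longrightarrow> norm x \<le> B"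
      by (auto simp: bounded_iff)
    then show "\<exists>R. \<forall>x. R \<le> norm x \<longrightarrow> f x = 0"
      by (intro exI[of _ "B + 1"]) force
  next
    assume "\<exists>R. \<forall>x. R \<le> norm x \<longrightarrow> f x = 0"
    then show "bounded {x. f x \<noteq> 0}"
      unfolding bounded_iff by (auto dest: leI) (meson linorder_linear)
  qed
  then show ?thesis
    by (simp add: test_functions_def)
qed

lemma test_functions_bounded_linear:
  assumes "bounded_linear L" "f \<in> test_functions"
  shows "(\<lambda>x. L (f x)) \<in> test_functions"
proof -
  obtain R where "\<forall>x. R \<le> norm x \<longrightarrow> f x = 0"
    using assms(2) by (auto simp: test_functions_iff)
  then have "\<forall>x. R \<le> norm x \<longrightarrow> L (f x) = 0"
    using linear_0[OF bounded_linear.linear[OF assms(1)]] by simp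
  moreover have "Ck k (\<lambda>x. L (f x))" for k
    using assms by (auto intro: Ck_bounded_linear_compose simp: test_functions_iff simp del: Ck.simps)
  ultimately show ?thesis
    unfolding test_functions_iff by blast
qed

lemma test_functions_has_derivative:
  "f \<in> test_functions \<Longrightarrow> (f has_derivative (\<lambda>v. dir_deriv v f x)) (at x)"
  by (rule Ck_SucD) (auto simp: test_functions_def simp del: Ck.simps)

lemma dir_deriv_scaleR:
  assumes "f \<in> test_functions"
  shows "dir_deriv (c *\<^sub>R v) f x = c *\<^sub>R dir_deriv v f x"
  using linear_scale[OF has_derivative_linear[OF test_functions_has_derivative[OF assms]]] .

lemma dir_deriv_bounded_linear:
  assumes "bounded_linear L" "f \<in> test_functions"
  shows "dir_deriv v (\<lambda>x. L (f x)) x = L (dir_deriv v f x)"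
  by (rule dir_deriv_eq[OF bounded_linear.has_derivative[OF assms(1)
          test_functions_has_derivative[OF assms(2)]]])

lemma dir_deriv_test_functions:
  assumes "f \<in> test_functions"
  shows "dir_deriv v f \<in> test_functions"
proof -
  obtain R where R: "\<And>x. R \<le> norm x \<Longrightarrow> f x = 0"
    using assms by (auto simp: test_functions_iff)
  have "dir_deriv v f x = 0" if "R + 1 \<le> norm x" for x
  proof -
    have "((\<lambda>_. 0) has_derivative (\<lambda>_. 0)) (at x)"
      by simp
    then have "(f has_derivative (\<lambda>_. 0)) (at x)"
      by (rule has_derivative_transform_within_open[where s="{x. R < norm x}"])
        (use that R in \<open>auto intro!: open_Collect_less continuous_intros\<close>)
    then show ?thesis by (rule dir_deriv_eq)
  qed
  moreover have "Ck k (dir_deriv v f)" for k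
    using assms Ck_SucD(2) by (auto simp: test_functions_def simp del: Ck.simps)
  ultimately show ?thesis
    unfolding test_functions_iff by blast
qed

section \<open>Averages along a segment\<close>

text \<open>Continuous real-valued functions of compact support.\<close>

definition cont_compact_support :: "('a::euclidean_space \<Rightarrow> real) set" where
  "cont_compact_support = {g. continuous_on UNIV g \<and> (\<exists>R. \<forall>x. R \<le> norm x \<longrightarrow> g x = 0)}"

lemma cont_compact_supportE:
  assumes "g \<in> cont_compact_support"
  obtains R where "0 < R" "\<And>x. R \<le> norm x \<Longrightarrow> g x = 0"
proof -
  obtain R where "\<And>x. R \<le> norm x \<Longrightarrow> g x = 0"
    using assms by (auto simp: cont_compact_support_def)
  then show thesis
    by (intro that[of "max R 1"]) auto
qed

lemma cont_compact_support_continuous: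
  "g \<in> cont_compact_support \<Longrightarrow> continuous_on UNIV g"
  by (simp add: cont_compact_support_def)

lemma cont_compact_support_bounded:
  assumes "g \<in> cont_compact_support"
  obtains B where "0 < B" "\<And>x. \<bar>g x\<bar> \<le> B"
proof -
  obtain R where R: "\<And>x. R \<le> norm x \<Longrightarrow> g x = 0"
    using cont_compact_supportE[OF assms] by blast
  have "compact (g ` cball 0 R)"
    using cont_compact_support_continuous[OF assms]
    by (intro compact_continuous_image) (auto intro: continuous_on_subset)
  then obtain B where B: "\<forall>x\<in>cball 0 R. \<bar>g x\<bar> \<le> B"
    by (auto dest!: compact_imp_bounded simp: bounded_iff)
  have "\<bar>g x\<bar> \<le> max B 1" for x
  proof (cases "R \<le> norm x")
    case False
    with B have "\<bar>g x\<bar> \<le> B" by simp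
    then show ?thesis by simp
  qed (simp add: R)
  then show thesis
    by (intro that[of "max B 1"]) auto
qed

lemma cont_compact_support_measurable:
  "g \<in> cont_compact_support \<Longrightarrow> g \<in> borel_measurable borel"
  by (simp add: cont_compact_support_def borel_measurable_continuous_onI)

lemma test_functions_cont_compact_support:
  "\<phi> \<in> test_functions \<Longrightarrow> \<phi> \<in> cont_compact_support"
  unfolding test_functions_iff cont_compact_support_def using Ck_continuous by blast

lemma cont_compact_support_add:
  assumes "f \<in> cont_compact_support" "g \<in> cont_compact_support"
  shows "(\<lambda>x. f x + g x) \<in> cont_compact_support"
proof -
  obtain R S where "\<And>x. R \<le> norm x \<Longrightarrow> f x = 0" "\<And>x. S \<le> norm x \<Longrightarrow> g x = 0"
    using assms by (metis cont_compact_supportE)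
  then have "\<forall>x. max R S \<le> norm x \<longrightarrow> f x + g x = 0" by simp
  moreover have "continuous_on UNIV (\<lambda>x. f x + g x)"
    using assms by (intro continuous_on_add cont_compact_support_continuous)
  ultimately show ?thesis
    unfolding cont_compact_support_def by blast
qed

lemma cont_compact_support_cmult:
  "f \<in> cont_compact_support \<Longrightarrow> (\<lambda>x. c * f x) \<in> cont_compact_support"
  by (auto simp: cont_compact_support_def intro!: continuous_on_mult)

lemma cont_compact_support_diff:
  "f \<in> cont_compact_support \<Longrightarrow> g \<in> cont_compact_support \<Longrightarrow>
    (\<lambda>x. f x - g x) \<in> cont_compact_support"
  using cont_compact_support_add[OF _ cont_compact_support_cmult[of g "-1"]] by simp

lemma cont_compact_support_sum:
  "finite I \<Longrightarrow> (\<And>i. i \<in> I \<Longrightarrow> g i \<in> cont_compact_support) \<Longrightarrow>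
    (\<lambda>x. \<Sum>i\<in>I. g i x) \<in> cont_compact_support"
proof (induction I rule: finite_induct)
  case empty
  show ?case by (simp add: cont_compact_support_def)
qed (auto intro: cont_compact_support_add)

lemma cont_compact_support_translate:
  assumes "g \<in> cont_compact_support"
  shows "(\<lambda>x. g (x + v)) \<in> cont_compact_support"
proof -
  obtain R where R: "\<And>x. R \<le> norm x \<Longrightarrow> g x = 0"
    using cont_compact_supportE[OF assms] by blast
  have "g (x + v) = 0" if "R + norm v \<le> norm x" for x
    using norm_triangle_ineq4[of "x + v" v] that by (intro R) simp
  moreover have "continuous_on UNIV (\<lambda>x. g (x + v))"
    by (rule continuous_on_compose2[OF cont_compact_support_continuous[OF assms]])
      (auto intro!: continuous_intros)
  ultimately show ?thesis
    unfolding cont_compact_support_def by blast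
qed

text \<open>The average of \<open>g\<close> over the segment from \<open>x\<close> to \<open>x + v\<close>.\<close>

definition line_avg :: "'a::euclidean_space \<Rightarrow> ('a \<Rightarrow> real) \<Rightarrow> 'a \<Rightarrow> real" where
  "line_avg v g x = integral {0..1} (\<lambda>t. g (x + t *\<^sub>R v))"

lemma continuous_on_along_segment:
  fixes g :: "'a::euclidean_space \<Rightarrow> 'b::topological_space"
  assumes "continuous_on UNIV g"
  shows "continuous_on S (\<lambda>t. g (x + t *\<^sub>R v))"
  by (rule continuous_on_compose2[OF assms]) (auto intro!: continuous_intros)

lemma integrable_along_segment:
  fixes g :: "'a::euclidean_space \<Rightarrow> real"
  shows "continuous_on UNIV g \<Longrightarrow> (\<lambda>t. g (x + t *\<^sub>R v)) integrable_on {0..1}"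
  by (intro integrable_continuous_real continuous_on_along_segment)

lemma continuous_on_line_avg:
  assumes "continuous_on UNIV g"
  shows "continuous_on UNIV (line_avg v g)"
proof -
  have "continuous_on (UNIV \<times> cbox 0 1) (\<lambda>(x, t::real). g (x + t *\<^sub>R v))"
    unfolding case_prod_beta
    by (rule continuous_on_compose2[OF assms]) (auto intro!: continuous_intros)
  from integral_continuous_on_param[OF this] show ?thesis
    by (simp add: line_avg_def[abs_def])
qed

lemma line_avg_support:
  assumes "\<And>x. R \<le> norm x \<Longrightarrow> g x = 0" "R + norm v \<le> norm x"
  shows "line_avg v g x = 0"
proof -
  have "g (x + t *\<^sub>R v) = 0" if "t \<in> {0..1}" for t
  proof (rule assms(1))
    have "norm (t *\<^sub>R v) \<le> norm v"
      using that by (simp add: mult_left_le_one_le)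
    then show "R \<le> norm (x + t *\<^sub>R v)"
      using norm_triangle_ineq4[of "x + t *\<^sub>R v" "t *\<^sub>R v"] assms(2) by simp
  qed
  then have "line_avg v g x = integral {0..1} (\<lambda>_::real. 0)"
    unfolding line_avg_def by (rule integral_cong)
  then show ?thesis by simp
qed

lemma line_avg_cont_compact_support:
  assumes "g \<in> cont_compact_support"
  shows "line_avg v g \<in> cont_compact_support"
  using assms line_avg_support[of _ g v] continuous_on_line_avg[of g v]
  unfolding cont_compact_support_def by blast

lemma line_avg_diff:
  "continuous_on UNIV f \<Longrightarrow> continuous_on UNIV g \<Longrightarrow>
    line_avg v (\<lambda>x. f x - g x) = (\<lambda>x. line_avg v f x - line_avg v g x)"
  unfolding line_avg_def by (intro ext integral_diff integrable_along_segment)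

lemma line_avg_sum:
  "finite I \<Longrightarrow> (\<And>i. i \<in> I \<Longrightarrow> continuous_on UNIV (g i)) \<Longrightarrow>
    line_avg v (\<lambda>x. \<Sum>i\<in>I. g i x) = (\<lambda>x. \<Sum>i\<in>I. line_avg v (g i) x)"
  unfolding line_avg_def by (intro ext integral_sum integrable_along_segment)

lemma line_avg_cmult: "line_avg v (\<lambda>x. c * g x) = (\<lambda>x. c * line_avg v g x)"
  by (simp add: line_avg_def[abs_def])

lemma line_avg_translate: "line_avg v (\<lambda>x. g (x + w)) = (\<lambda>x. line_avg v g (x + w))"
  by (simp add: line_avg_def[abs_def] add.assoc add.commute[of _ w])

lemma line_avg_commute:
  assumes "continuous_on UNIV g"
  shows "line_avg v (line_avg w g) = line_avg w (line_avg v g)"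
proof
  fix x
  have "continuous_on (cbox (0::real, 0::real) (1, 1)) (\<lambda>(t, s). g (x + t *\<^sub>R v + s *\<^sub>R w))"
    unfolding case_prod_beta
    by (rule continuous_on_compose2[OF assms]) (auto intro!: continuous_intros)
  from integral_swap_continuous[OF this]
  show "line_avg v (line_avg w g) x = line_avg w (line_avg v g) x"
    by (simp add: line_avg_def add.assoc add.commute[of "_ *\<^sub>R w"])
qed

text \<open>The fundamental theorem of calculus along a segment.\<close>

lemma line_avg_dir_deriv:
  assumes "\<psi> \<in> test_functions"
  shows "line_avg v (dir_deriv v \<psi>) x = \<psi> (x + v) - \<psi> x"
proof -
  have "((\<lambda>t. \<psi> (x + t *\<^sub>R v)) has_vector_derivative dir_deriv v \<psi> (x + t *\<^sub>R v))
      (at t within {0..1})" for t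
  proof -
    have "((\<lambda>t. \<psi> (x + t *\<^sub>R v)) has_derivative (\<lambda>s. dir_deriv (s *\<^sub>R v) \<psi> (x + t *\<^sub>R v))) (at t within {0..1})"
      by (rule has_derivative_compose[OF _ test_functions_has_derivative[OF assms]])
        (auto intro!: derivative_eq_intros)
    then show ?thesis
      by (simp add: has_vector_derivative_def dir_deriv_scaleR[OF assms])
  qed
  from integral_unique[OF fundamental_theorem_of_calculus[OF _ this]] show ?thesis
    by (simp add: line_avg_def)
qed

lemma line_avg_has_derivative:
  assumes "\<And>x. (\<psi> has_derivative (\<lambda>h. D h x)) (at x)" and "\<And>h. continuous_on UNIV (D h)"
  shows "(line_avg v \<psi> has_derivative (\<lambda>h. line_avg v (D h) x)) (at x)"
proof -
  define B where "B y = Blinfun (\<lambda>h. D h y)" for y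
  have B: "blinfun_apply (B y) h = D h y" for y h
    unfolding B_def
    by (subst bounded_linear_Blinfun_apply) (auto intro: has_derivative_bounded_linear assms(1))
  have cB: "continuous_on UNIV B"
    by (rule continuous_on_blinfun_componentwise) (simp add: B assms(2))
  have "continuous_on UNIV \<psi>"
    using assms(1) has_derivative_continuous by (metis continuous_at_imp_continuous_on)
  then have int: "(\<lambda>t. \<psi> (y + t *\<^sub>R v)) integrable_on cbox 0 1" for y
    using integrable_along_segment[of \<psi> y v] by simp
  have "((\<lambda>y. integral (cbox 0 1) (\<lambda>t. \<psi> (y + t *\<^sub>R v))) has_derivative
      blinfun_apply (integral (cbox 0 1) (\<lambda>t. B (x + t *\<^sub>R v)))) (at x within UNIV)"
  proof (rule leibniz_rule[OF _ int])
    show "((\<lambda>y. \<psi> (y + t *\<^sub>R v)) has_derivative blinfun_apply (B (y + t *\<^sub>R v))) (at y within UNIV)"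
      for y t
    proof -
      have "((\<lambda>y. \<psi> (y + t *\<^sub>R v)) has_derivative (\<lambda>h. D h (y + t *\<^sub>R v))) (at y)"
        by (rule has_derivative_compose[OF _ assms(1)]) (auto intro!: derivative_eq_intros)
      then show ?thesis by (simp add: B[symmetric])
    qed
    show "continuous_on (UNIV \<times> cbox 0 1) (\<lambda>(y, t). B (y + t *\<^sub>R v))"
      unfolding case_prod_beta
      by (rule continuous_on_compose2[OF cB]) (auto intro!: continuous_intros)
  qed auto
  moreover have "blinfun_apply (integral (cbox 0 1) (\<lambda>t. B (x + t *\<^sub>R v)))
      = (\<lambda>h. line_avg v (D h) x)"
  proof
    fix h
    have "(\<lambda>t. B (x + t *\<^sub>R v)) integrable_on cbox 0 1"
      using continuous_on_along_segment[OF cB, of "cbox 0 1" x v] by (rule integrable_continuous)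
    then show "blinfun_apply (integral (cbox 0 1) (\<lambda>t. B (x + t *\<^sub>R v))) h = line_avg v (D h) x"
      by (subst blinfun_apply_integral) (simp_all add: B line_avg_def)
  qed
  ultimately show ?thesis
    by (simp add: line_avg_def[abs_def])
qed

lemma Ck_line_avg: "Ck k \<psi> \<Longrightarrow> Ck k (line_avg v \<psi>)"
proof (induction k arbitrary: \<psi>)
  case 0
  then show ?case by (simp add: continuous_on_line_avg)
next
  case (Suc k)
  show ?case
    by (rule Ck_SucI[OF line_avg_has_derivative[OF Ck_SucD(1)[OF Suc.prems]]])
      (intro Ck_continuous[OF Ck_SucD(2)[OF Suc.prems]] Suc.IH Ck_SucD(2)[OF Suc.prems])+
qed

lemma line_avg_test_functions:
  assumes "\<psi> \<in> test_functions"
  shows "line_avg v \<psi> \<in> test_functions"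
  using assms line_avg_cont_compact_support[OF test_functions_cont_compact_support[OF assms]]
  by (auto simp: test_functions_iff cont_compact_support_def intro: Ck_line_avg)

lemma dir_deriv_line_avg:
  assumes "\<psi> \<in> test_functions"
  shows "dir_deriv w (line_avg v \<psi>) x = line_avg v (dir_deriv w \<psi>) x"
  by (rule dir_deriv_eq[OF line_avg_has_derivative[OF test_functions_has_derivative[OF assms]]])
    (intro cont_compact_support_continuous test_functions_cont_compact_support
      dir_deriv_test_functions assms)

section \<open>Extended powers and \<open>L\<^sup>p\<close>-norms\<close>

lemma epowr_ennreal: "0 \<le> x \<Longrightarrow> epowr (ennreal x) a = ennreal (x powr a)"
  by (simp add: epowr_def)

lemma epowr_top [simp]: "epowr top a = top"
  by (simp add: epowr_def)

lemma epowr_mono: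
  assumes "0 < a" "x \<le> y"
  shows "epowr x a \<le> epowr y a"
  using assms
  by (cases x; cases y) (auto simp: epowr_ennreal powr_mono2 top_unique intro!: ennreal_leI)

lemma epowr_mult:
  assumes "0 < c"
  shows "epowr (ennreal c * x) a = ennreal (c powr a) * epowr x a"
  using assms
  by (cases x) (auto simp: epowr_ennreal powr_mult ennreal_mult_top simp flip: ennreal_mult)

lemma epowr_inverse:
  assumes "0 < a"
  shows "epowr (epowr x a) (1 / a) = x" "epowr (epowr x (1 / a)) a = x"
  using assms by (cases x; simp add: epowr_ennreal powr_powr)+

lemma epowr_root_le_iff:
  assumes "0 < a" "0 \<le> c"
  shows "epowr x (1 / a) \<le> ennreal c \<longleftrightarrow> x \<le> ennreal (c powr a)"
proof
  assume "epowr x (1 / a) \<le> ennreal c"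
  then have "epowr (epowr x (1 / a)) a \<le> epowr (ennreal c) a"
    using assms by (intro epowr_mono)
  then show "x \<le> ennreal (c powr a)"
    using assms by (simp add: epowr_inverse epowr_ennreal)
next
  assume "x \<le> ennreal (c powr a)"
  then have "epowr x (1 / a) \<le> epowr (ennreal (c powr a)) (1 / a)"
    using assms by (intro epowr_mono) auto
  then show "epowr x (1 / a) \<le> ennreal c"
    using assms by (simp add: epowr_ennreal powr_powr)
qed

lemma Lp_norm_ennreal:
  assumes "1 \<le> r"
  shows "Lp_norm (ennreal r) f = epowr (\<integral>\<^sup>+x. ennreal (norm (f x) powr r) \<partial>lborel) (1 / r)"
  using assms by (simp add: Lp_norm_def nn_integral_completion)

lemma Lp_norm_le_iff:
  assumes "1 \<le> r" "0 \<le> c"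
  shows "Lp_norm (ennreal r) f \<le> ennreal c
    \<longleftrightarrow> (\<integral>\<^sup>+x. ennreal (norm (f x) powr r) \<partial>lborel) \<le> ennreal (c powr r)"
  using assms by (simp add: Lp_norm_ennreal epowr_root_le_iff)

lemma Lp_norm_top_leI:
  assumes "f \<in> borel_measurable borel" "\<And>x. norm (f x) \<le> c"
  shows "Lp_norm top f \<le> ennreal c"
proof -
  have "f \<in> borel_measurable lebesgue"
    using assms(1) by (simp add: measurable_completion)
  then show ?thesis
    unfolding Lp_norm_def using assms(2) by (auto intro!: esssup_I AE_I2 ennreal_leI)
qed

lemma Lp_norm_top_leD:
  assumes "Lp_norm top f \<le> ennreal c" "0 \<le> c"
  shows "AE x in lborel. norm (f x) \<le> c"
proof -
  have "AE x in lebesgue. ennreal (norm (f x)) \<le> esssup lebesgue (\<lambda>x. ennreal (norm (f x)))"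
    by (rule esssup_AE)
  then have "AE x in lborel. ennreal (norm (f x)) \<le> esssup lebesgue (\<lambda>x. ennreal (norm (f x)))"
    by (simp add: AE_completion_iff)
  then show ?thesis
  proof eventually_elim
    case (elim x)
    then have "ennreal (norm (f x)) \<le> ennreal c"
      using assms(1) by (simp add: Lp_norm_def)
    then show ?case
      using assms(2) by simp
  qed
qed

lemma AE_le_continuous_imp_le:
  fixes f :: "'a::euclidean_space \<Rightarrow> real"
  assumes "continuous_on UNIV f" "AE x in lborel. f x \<le> c"
  shows "f x \<le> c"
proof (rule ccontr)
  assume "\<not> f x \<le> c"
  moreover have "open {x. c < f x}"
    using assms(1) by (intro open_Collect_less) auto
  ultimately have "\<not> negligible {x. c < f x}"
    using \<open>\<not> f x \<le> c\<close> by (intro open_not_negligible) (auto simp: not_le)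
  moreover have "negligible {x. c < f x}"
    unfolding negligible_iff_null_sets
  proof (rule AE_iff_null_sets[THEN iffD2])
    show "AE x in lebesgue. x \<notin> {x. c < f x}"
      using AE_completion[OF assms(2)] by (simp add: not_less)
  qed (use \<open>open {x. c < f x}\<close> in \<open>auto intro: sets_completionI_sets\<close>)
  ultimately show False by contradiction
qed

lemma Lp_norm_top_le_iff:
  assumes "g \<in> cont_compact_support" "0 \<le> c"
  shows "Lp_norm top g \<le> ennreal c \<longleftrightarrow> (\<forall>x. \<bar>g x\<bar> \<le> c)"
proof
  assume "Lp_norm top g \<le> ennreal c"
  then have "AE x in lborel. \<bar>g x\<bar> \<le> c"
    using Lp_norm_top_leD[OF _ assms(2), of g] by simp
  then show "\<forall>x. \<bar>g x\<bar> \<le> c"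
    using cont_compact_support_continuous[OF assms(1)]
    by (intro allI AE_le_continuous_imp_le) (auto intro: continuous_intros)
next
  assume "\<forall>x. \<bar>g x\<bar> \<le> c"
  then show "Lp_norm top g \<le> ennreal c"
    by (intro Lp_norm_top_leI cont_compact_support_measurable[OF assms(1)]) auto
qed

lemma conj_exponent_cases:
  assumes "1 \<le> p"
  obtains "p = 1" "conj_exponent p = top"
  | q where "1 < p" "1 < q" "conj_exponent p = ennreal q" "1 / p + 1 / q = 1"
proof (cases "p = 1")
  case False
  then show thesis
    using assms by (intro that(2)[of "p / (p - 1)"]) (auto simp: conj_exponent_def field_simps)
qed (simp add: that conj_exponent_def)

lemma Lp_norm_mono:
  assumes "1 \<le> p" "f \<in> borel_measurable borel" "\<And>x. norm (f x) \<le> norm (g x)"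
  shows "Lp_norm (conj_exponent p) f \<le> Lp_norm (conj_exponent p) g"
  using assms(1)
proof (cases rule: conj_exponent_cases)
  case 1
  have "f \<in> borel_measurable lebesgue"
    using assms(2) by (simp add: measurable_completion)
  then show ?thesis
    unfolding Lp_norm_def using 1 assms(3) by (auto intro!: esssup_mono ennreal_leI)
next
  case (2 q)
  with assms(3) show ?thesis
    by (auto simp: Lp_norm_ennreal intro!: epowr_mono nn_integral_mono ennreal_leI powr_mono2)
qed

text \<open>The tangent-line inequality for the convex function \<open>x\<^sup>r\<close>, from which Jensen's inequality
  follows by integration.\<close>

lemma powr_tangent:
  fixes r x m :: real
  assumes "1 \<le> r" "0 \<le> x" "0 \<le> m"
  shows "x * m powr (r - 1) \<le> x powr r / r + (1 - 1 / r) * m powr r"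
proof (cases "r = 1")
  case True
  with assms show ?thesis by (cases "m = 0") simp_all
next
  case False
  define s where "s = r / (r - 1)"
  have s: "1 < r" "1 < s" "1 / r + 1 / s = 1"
    using False assms by (auto simp: s_def field_simps)
  have "(m powr (r - 1)) powr s = m powr r"
    using s by (simp add: powr_powr s_def)
  moreover have "1 / s = 1 - 1 / r"
    using s by simp
  ultimately show ?thesis
    using Youngs_inequality[OF s assms(2), of "m powr (r - 1)"]
    by (simp add: divide_inverse mult.commute)
qed

text \<open>Jensen's inequality for the uniform measure on a segment.\<close>

lemma line_avg_powr_le:
  assumes "continuous_on UNIV g" "1 \<le> r"
  shows "\<bar>line_avg v g x\<bar> powr r \<le> line_avg v (\<lambda>y. \<bar>g y\<bar> powr r) x"
proof -
  define m where "m = line_avg v (\<lambda>y. \<bar>g y\<bar>) x"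
  have c1: "continuous_on UNIV (\<lambda>y. \<bar>g y\<bar>)"
    using assms by (intro continuous_intros)
  have c2: "continuous_on UNIV (\<lambda>y. \<bar>g y\<bar> powr r)"
    using assms by (intro continuous_on_powr' continuous_intros) auto
  have m0: "0 \<le> m"
    unfolding m_def line_avg_def by (intro integral_nonneg integrable_along_segment[OF c1]) simp
  have "\<bar>line_avg v g x\<bar> \<le> m"
    unfolding m_def line_avg_def
    using integral_norm_bound_integral[OF integrable_along_segment[OF assms(1)]
        integrable_along_segment[OF c1]] by simp
  then have "\<bar>line_avg v g x\<bar> powr r \<le> m powr r"
    using assms by (intro powr_mono2) auto
  also have "m powr r \<le> line_avg v (\<lambda>y. \<bar>g y\<bar> powr r) x"
  proof -
    have "integral {0..1} (\<lambda>t. \<bar>g (x + t *\<^sub>R v)\<bar> * m powr (r - 1))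
      \<le> integral {0..1} (\<lambda>t. \<bar>g (x + t *\<^sub>R v)\<bar> powr r / r + (1 - 1 / r) * m powr r)"
      using assms m0
      by (intro integral_le powr_tangent integrable_add integrable_on_mult_left
          integrable_on_divide integrable_along_segment[OF c1] integrable_along_segment[OF c2]
          integrable_const_ivl) auto
    also have "\<dots> = line_avg v (\<lambda>y. \<bar>g y\<bar> powr r) x / r + (1 - 1 / r) * m powr r"
      unfolding line_avg_def
      by (subst integral_add) (auto intro!: integrable_on_divide integrable_along_segment[OF c2])
    finally have "m * m powr (r - 1) \<le> line_avg v (\<lambda>y. \<bar>g y\<bar> powr r) x / r + (1 - 1 / r) * m powr r"
      by (simp add: m_def line_avg_def)
    moreover have "m * m powr (r - 1) = m powr r"
      using m0 by (cases "m = 0") (auto simp: powr_mult_base)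
    ultimately have "m powr r / r \<le> line_avg v (\<lambda>y. \<bar>g y\<bar> powr r) x / r"
      by (simp add: left_diff_distrib)
    then show ?thesis
      using assms(2) by (simp add: divide_le_cancel)
  qed
  finally show ?thesis .
qed

lemma nn_integral_lborel_translate:
  fixes F :: "'a::euclidean_space \<Rightarrow> ennreal"
  assumes "F \<in> borel_measurable borel"
  shows "(\<integral>\<^sup>+x. F (x + v) \<partial>lborel) = (\<integral>\<^sup>+x. F x \<partial>lborel)"
proof -
  have "(\<integral>\<^sup>+x. F x \<partial>lborel) = (\<integral>\<^sup>+x. F x \<partial>distr lborel borel ((+) v))"
    by (simp add: lborel_distr_plus)
  also have "\<dots> = (\<integral>\<^sup>+x. F (x + v) \<partial>lborel)"
    using assms by (subst nn_integral_distr) (auto simp: add.commute)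
  finally show ?thesis ..
qed

lemma integral_lborel_translate:
  fixes F :: "'a::euclidean_space \<Rightarrow> real"
  assumes "F \<in> borel_measurable borel"
  shows "(\<integral>x. F (x + v) \<partial>lborel) = (\<integral>x. F x \<partial>lborel)"
proof -
  have "(\<integral>x. F x \<partial>lborel) = (\<integral>x. F x \<partial>distr lborel borel ((+) v))"
    by (simp add: lborel_distr_plus)
  also have "\<dots> = (\<integral>x. F (x + v) \<partial>lborel)"
    using assms by (subst integral_distr) (auto simp: add.commute)
  finally show ?thesis ..
qed

lemma integrable_lborel_translate:
  fixes F :: "'a::euclidean_space \<Rightarrow> real"
  assumes "integrable lborel F"
  shows "integrable lborel (\<lambda>x. F (x + v))"
proof -
  have "integrable (distr lborel borel ((+) v)) F"
    using assms by (simp add: lborel_distr_plus)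
  then have "integrable lborel (\<lambda>x. F (v + x))"
    by (subst (asm) integrable_distr_eq) (use assms in auto)
  then show ?thesis by (simp add: add.commute)
qed

text \<open>Averaging along a segment is a contraction in every \<open>L\<^sup>q\<close>.\<close>

lemma Lp_norm_line_avg_le:
  assumes "1 \<le> p" "g \<in> cont_compact_support" "0 \<le> c" "Lp_norm (conj_exponent p) g \<le> ennreal c"
  shows "Lp_norm (conj_exponent p) (line_avg v g) \<le> ennreal c"
  using assms(1)
proof (cases rule: conj_exponent_cases)
  case 1
  note cont = cont_compact_support_continuous[OF assms(2)]
  have "\<forall>x. \<bar>g x\<bar> \<le> c"
    using assms 1 by (simp add: Lp_norm_top_le_iff)
  then have "\<bar>line_avg v g x\<bar> \<le> c" for x
    unfolding line_avg_def
    using integral_norm_bound_integral[OF integrable_along_segment[OF cont], of "\<lambda>_. c" x v] by auto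
  then show ?thesis
    using assms 1 by (simp add: Lp_norm_top_le_iff line_avg_cont_compact_support)
next
  case (2 r)
  note cont = cont_compact_support_continuous[OF assms(2)]
  have c2: "continuous_on UNIV (\<lambda>y. \<bar>g y\<bar> powr r)"
    using cont 2 by (intro continuous_on_powr' continuous_intros) auto
  define F where "F y = ennreal (\<bar>g y\<bar> powr r)" for y
  have F [measurable]: "F \<in> borel_measurable borel"
    unfolding F_def using borel_measurable_continuous_onI[OF c2] by simp
  have "(\<integral>\<^sup>+x. ennreal (\<bar>line_avg v g x\<bar> powr r) \<partial>lborel)
      \<le> (\<integral>\<^sup>+x. (\<integral>\<^sup>+t. F (x + t *\<^sub>R v) * indicator {0..1::real} t \<partial>lborel) \<partial>lborel)"
  proof (rule nn_integral_mono)
    fix x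
    have "((\<lambda>t. \<bar>g (x + t *\<^sub>R v)\<bar> powr r) has_integral line_avg v (\<lambda>y. \<bar>g y\<bar> powr r) x) {0..1}"
      unfolding line_avg_def using integrable_along_segment[OF c2] by (rule integrable_integral)
    from nn_integral_has_integral_lebesgue'[OF _ this]
    have "(\<integral>\<^sup>+t. F (x + t *\<^sub>R v) * indicator {0..1::real} t \<partial>lborel)
        = ennreal (line_avg v (\<lambda>y. \<bar>g y\<bar> powr r) x)"
      by (simp add: F_def)
    then show "ennreal (\<bar>line_avg v g x\<bar> powr r)
        \<le> (\<integral>\<^sup>+t. F (x + t *\<^sub>R v) * indicator {0..1::real} t \<partial>lborel)"
      using line_avg_powr_le[OF cont, of r v x] 2 by (simp add: ennreal_leI)
  qed
  also have "\<dots> = (\<integral>\<^sup>+t. (\<integral>\<^sup>+x. F (x + t *\<^sub>R v) * indicator {0..1::real} t \<partial>lborel) \<partial>lborel)"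
    by (rule lborel_pair.Fubini'[symmetric]) measurable
  also have "\<dots> = (\<integral>\<^sup>+t. (\<integral>\<^sup>+x. F x \<partial>lborel) * indicator {0..1::real} t \<partial>lborel)"
    by (intro nn_integral_cong) (simp add: nn_integral_multc nn_integral_lborel_translate)
  also have "\<dots> = (\<integral>\<^sup>+x. F x \<partial>lborel)"
    by (simp add: nn_integral_cmult)
  also have "\<dots> \<le> ennreal (c powr r)"
    using assms 2 by (simp add: Lp_norm_le_iff F_def)
  finally show ?thesis
    using assms 2 by (simp add: Lp_norm_le_iff)
qed

lemma Lp_norm_cmult_le:
  assumes "1 \<le> p" "g \<in> cont_compact_support" "0 \<le> c" "0 \<le> a"
    and "Lp_norm (conj_exponent p) g \<le> ennreal c"
  shows "Lp_norm (conj_exponent p) (\<lambda>x. a * g x) \<le> ennreal (a * c)"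
  using assms(1)
proof (cases rule: conj_exponent_cases)
  case 1
  with assms show ?thesis
    by (auto simp: Lp_norm_top_le_iff cont_compact_support_cmult abs_mult mult_left_mono)
next
  case (2 r)
  have [measurable]: "g \<in> borel_measurable borel"
    by (rule cont_compact_support_measurable[OF assms(2)])
  have "(\<integral>\<^sup>+x. ennreal (norm (a * g x) powr r) \<partial>lborel)
      = (\<integral>\<^sup>+x. ennreal (a powr r) * ennreal (norm (g x) powr r) \<partial>lborel)"
    using assms by (simp add: abs_mult powr_mult ennreal_mult')
  also have "\<dots> = ennreal (a powr r) * (\<integral>\<^sup>+x. ennreal (norm (g x) powr r) \<partial>lborel)"
    by (rule nn_integral_cmult) simp
  also have "\<dots> \<le> ennreal (a powr r) * ennreal (c powr r)"
    using assms 2 by (intro mult_left_mono) (auto simp: Lp_norm_le_iff)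
  also have "\<dots> = ennreal ((a * c) powr r)"
    using assms by (simp add: powr_mult ennreal_mult')
  finally show ?thesis
    unfolding 2(3) using assms 2 by (subst Lp_norm_le_iff) simp_all
qed

lemma Lp_norm_half_difference_le:
  assumes "1 \<le> p" "g \<in> cont_compact_support" "0 \<le> c" "Lp_norm (conj_exponent p) g \<le> ennreal c"
  shows "Lp_norm (conj_exponent p) (\<lambda>x. (g (x + v) - g x) / 2) \<le> ennreal c"
  using assms(1)
proof (cases rule: conj_exponent_cases)
  case 1
  then have b: "\<bar>g x\<bar> \<le> c" for x
    using assms by (simp add: Lp_norm_top_le_iff)
  have "\<bar>(g (x + v) - g x) / 2\<bar> \<le> c" for x
    using b[of x] b[of "x + v"] by (simp add: abs_le_iff)
  then show ?thesis
    unfolding 1(2) using cont_compact_support_measurable[OF assms(2)]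
    by (intro Lp_norm_top_leI) auto
next
  case (2 r)
  have [measurable]: "g \<in> borel_measurable borel"
    by (rule cont_compact_support_measurable[OF assms(2)])
  have pw: "\<bar>(a - b) / 2\<bar> powr r \<le> (\<bar>a\<bar> powr r + \<bar>b\<bar> powr r) / 2" for a b :: real
  proof -
    define m where "m = (\<bar>a\<bar> + \<bar>b\<bar>) / 2"
    have "\<bar>(a - b) / 2\<bar> powr r \<le> m powr r"
      unfolding m_def using 2 by (intro powr_mono2) auto
    moreover have "(\<bar>a\<bar> + \<bar>b\<bar>) * m powr (r - 1)
        \<le> (\<bar>a\<bar> powr r + \<bar>b\<bar> powr r) / r + 2 * (1 - 1 / r) * m powr r"
      using powr_tangent[of r "\<bar>a\<bar>" m] powr_tangent[of r "\<bar>b\<bar>" m] 2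
      by (simp add: m_def algebra_simps add_divide_distrib)
    moreover have "(\<bar>a\<bar> + \<bar>b\<bar>) * m powr (r - 1) = 2 * m powr r"
      using powr_mult_base[of m "r - 1"] by (cases "m = 0") (auto simp: m_def)
    ultimately have "2 * m powr r / r \<le> (\<bar>a\<bar> powr r + \<bar>b\<bar> powr r) / r"
      by (simp add: algebra_simps)
    then have "2 * m powr r \<le> \<bar>a\<bar> powr r + \<bar>b\<bar> powr r"
      using 2 by (simp add: divide_le_cancel)
    with \<open>\<bar>(a - b) / 2\<bar> powr r \<le> m powr r\<close> show ?thesis by simp
  qed
  define F where "F y = ennreal (\<bar>g y\<bar> powr r)" for y
  have F [measurable]: "F \<in> borel_measurable borel"
    unfolding F_def by measurable
  have "(\<integral>\<^sup>+x. ennreal (norm ((g (x + v) - g x) / 2) powr r) \<partial>lborel)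
      \<le> (\<integral>\<^sup>+x. ennreal (1 / 2) * (F (x + v) + F x) \<partial>lborel)"
  proof (rule nn_integral_mono)
    fix x
    have "ennreal (norm ((g (x + v) - g x) / 2) powr r)
        \<le> ennreal (1 / 2 * (\<bar>g (x + v)\<bar> powr r + \<bar>g x\<bar> powr r))"
      using pw[of "g (x + v)" "g x"] by (intro ennreal_leI) simp
    also have "\<dots> = ennreal (1 / 2) * (F (x + v) + F x)"
      unfolding F_def by (subst ennreal_mult) auto
    finally show "ennreal (norm ((g (x + v) - g x) / 2) powr r)
        \<le> ennreal (1 / 2) * (F (x + v) + F x)" .
  qed
  also have "\<dots> = ennreal (1 / 2) * ((\<integral>\<^sup>+x. F x \<partial>lborel) + (\<integral>\<^sup>+x. F x \<partial>lborel))"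
    by (simp add: nn_integral_cmult nn_integral_add nn_integral_lborel_translate)
  also have "\<dots> \<le> ennreal (1 / 2) * (ennreal (c powr r) + ennreal (c powr r))"
    using assms 2 by (intro mult_left_mono add_mono) (auto simp: Lp_norm_le_iff F_def)
  also have "\<dots> = ennreal (1 / 2) * ennreal (2 * c powr r)"
    by (subst ennreal_plus[symmetric]) auto
  also have "\<dots> = ennreal (c powr r)"
    by (subst ennreal_mult[symmetric]) auto
  finally show ?thesis
    using assms 2 by (simp add: Lp_norm_le_iff)
qed

text \<open>The bounds \<open>c\<close> and \<open>d\<close> are positive upper bounds for the norms rather than the norms
  themselves, which spares a separate treatment of norms that vanish or are infinite.\<close>

lemma Hoelder_real:
  fixes F g :: "'a::euclidean_space \<Rightarrow> real"
  assumes [measurable]: "F \<in> borel_measurable borel" "g \<in> borel_measurable borel"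
    and "1 \<le> p" "0 < c" "0 < d"
    and "Lp_norm (ennreal p) F \<le> ennreal c" "Lp_norm (conj_exponent p) g \<le> ennreal d"
  shows "(\<integral>\<^sup>+x. ennreal \<bar>F x * g x\<bar> \<partial>lborel) \<le> ennreal (c * d)"
  using assms(3)
proof (cases rule: conj_exponent_cases)
  case 1
  have "AE x in lborel. \<bar>g x\<bar> \<le> d"
    using Lp_norm_top_leD[of g d] assms 1 by simp
  then have "(\<integral>\<^sup>+x. ennreal \<bar>F x * g x\<bar> \<partial>lborel) \<le> (\<integral>\<^sup>+x. ennreal \<bar>F x\<bar> * ennreal d \<partial>lborel)"
    by (intro nn_integral_mono_AE, eventually_elim)
      (auto simp: abs_mult mult_left_mono simp flip: ennreal_mult' intro!: ennreal_leI)
  also have "\<dots> = (\<integral>\<^sup>+x. ennreal \<bar>F x\<bar> \<partial>lborel) * ennreal d"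
    by (rule nn_integral_multc) simp
  also have "\<dots> \<le> ennreal c * ennreal d"
    using assms 1 Lp_norm_le_iff[of 1 c F] by (intro mult_right_mono) auto
  finally show ?thesis
    using assms by (simp add: ennreal_mult')
next
  case (2 q)
  \<comment> \<open>Young's inequality for \<^term>\<open>\<bar>F x\<bar> / c\<close> and \<^term>\<open>\<bar>g x\<bar> / d\<close>.\<close>
  have le: "\<bar>F x * g x\<bar>
      \<le> (c * d / (p * c powr p)) * \<bar>F x\<bar> powr p + (c * d / (q * d powr q)) * \<bar>g x\<bar> powr q" for x
  proof -
    have "(\<bar>F x\<bar> / c) * (\<bar>g x\<bar> / d) \<le> (\<bar>F x\<bar> / c) powr p / p + (\<bar>g x\<bar> / d) powr q / q"
      using assms 2 by (intro Youngs_inequality) auto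
    then have "(c * d) * ((\<bar>F x\<bar> / c) * (\<bar>g x\<bar> / d))
        \<le> (c * d) * ((\<bar>F x\<bar> / c) powr p / p + (\<bar>g x\<bar> / d) powr q / q)"
      using assms by (intro mult_left_mono) auto
    then show ?thesis
      using assms by (simp add: abs_mult powr_divide field_simps)
  qed
  define A B where "A = c * d / (p * c powr p)" and "B = c * d / (q * d powr q)"
  have AB: "0 \<le> A" "0 \<le> B"
    using assms 2 by (auto simp: A_def B_def)
  have "(\<integral>\<^sup>+x. ennreal \<bar>F x * g x\<bar> \<partial>lborel)
      \<le> (\<integral>\<^sup>+x. ennreal A * ennreal (\<bar>F x\<bar> powr p) + ennreal B * ennreal (\<bar>g x\<bar> powr q) \<partial>lborel)"
  proof (rule nn_integral_mono)
    fix x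
    have "ennreal \<bar>F x * g x\<bar> \<le> ennreal (A * \<bar>F x\<bar> powr p + B * \<bar>g x\<bar> powr q)"
      using le[of x] unfolding A_def B_def by (rule ennreal_leI)
    also have "\<dots> = ennreal A * ennreal (\<bar>F x\<bar> powr p) + ennreal B * ennreal (\<bar>g x\<bar> powr q)"
      using AB by (simp add: ennreal_mult')
    finally show "ennreal \<bar>F x * g x\<bar>
        \<le> ennreal A * ennreal (\<bar>F x\<bar> powr p) + ennreal B * ennreal (\<bar>g x\<bar> powr q)" .
  qed
  also have "\<dots> = ennreal A * (\<integral>\<^sup>+x. ennreal (\<bar>F x\<bar> powr p) \<partial>lborel)
      + ennreal B * (\<integral>\<^sup>+x. ennreal (\<bar>g x\<bar> powr q) \<partial>lborel)"
    by (simp add: nn_integral_add nn_integral_cmult)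
  also have "\<dots> \<le> ennreal A * ennreal (c powr p) + ennreal B * ennreal (d powr q)"
    using assms 2 Lp_norm_le_iff[of p c F] Lp_norm_le_iff[of q d g]
    by (intro add_mono mult_left_mono) auto
  also have "\<dots> = ennreal (A * c powr p + B * d powr q)"
    using AB by (simp add: ennreal_mult')
  also have "A * c powr p + B * d powr q = c * d * (1 / p + 1 / q)"
    using assms 2 by (simp add: A_def B_def field_simps)
  finally show ?thesis
    using 2 by simp
qed

lemma ennreal_abs_integral_le: "ennreal \<bar>\<integral>x. u x \<partial>M\<bar> \<le> (\<integral>\<^sup>+x. ennreal \<bar>u x\<bar> \<partial>M)"
proof (cases "integrable M u")
  case True
  from integral_norm_bound_ennreal[OF this] show ?thesis by simp
qed (simp add: not_integrable_integral_eq)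

lemma Hoelder:
  fixes F g :: "'a::euclidean_space \<Rightarrow> real"
  assumes "F \<in> borel_measurable borel" "g \<in> borel_measurable borel" "1 \<le> p" "0 < d"
    and "Lp_norm (ennreal p) F \<le> W" "Lp_norm (conj_exponent p) g \<le> ennreal d"
  shows "ennreal \<bar>\<integral>x. F x * g x \<partial>lborel\<bar> \<le> W * ennreal d"
proof (cases W)
  case top
  with assms show ?thesis by (simp add: ennreal_top_mult)
next
  case (real w)
  have "ennreal \<bar>\<integral>x. F x * g x \<partial>lborel\<bar> \<le> (\<integral>\<^sup>+x. ennreal \<bar>F x * g x\<bar> \<partial>lborel)"
    by (rule ennreal_abs_integral_le)
  also have "\<dots> \<le> ennreal (w * d)"
  proof (rule ennreal_le_epsilon)
    fix e :: real assume "0 < e"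
    have "w \<le> w + e / d"
      using \<open>0 < e\<close> assms by simp
    then have "Lp_norm (ennreal p) F \<le> ennreal (w + e / d)"
      using assms(5) real by (metis ennreal_leI order_trans)
    then have "(\<integral>\<^sup>+x. ennreal \<bar>F x * g x\<bar> \<partial>lborel) \<le> ennreal ((w + e / d) * d)"
      using real \<open>0 < e\<close> assms by (intro Hoelder_real) (auto intro: add_nonneg_pos)
    also have "(w + e / d) * d = w * d + e"
      using assms by (simp add: field_simps)
    finally show "(\<integral>\<^sup>+x. ennreal \<bar>F x * g x\<bar> \<partial>lborel) \<le> ennreal (w * d) + ennreal e"
      using real \<open>0 < e\<close> assms by simp
  qed
  finally show ?thesis
    using real by (simp add: ennreal_mult')
qed

text \<open>Integrability over balls. Borel rather than Lebesgue measurability is required, so that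
  products such as \<open>(t, x) \<mapsto> f x * g (x + t v)\<close> are measurable for the product measure.\<close>

definition locally_integrable :: "('a::euclidean_space \<Rightarrow> real) \<Rightarrow> bool" where
  "locally_integrable f \<longleftrightarrow> f \<in> borel_measurable borel
    \<and> (\<forall>R. integrable lborel (\<lambda>x. indicator (ball 0 R) x * f x))"

lemma locally_integrableD:
  assumes "locally_integrable f"
  shows "f \<in> borel_measurable borel" "integrable lborel (\<lambda>x. indicator (ball 0 R) x * f x)"
  using assms by (auto simp: locally_integrable_def)

lemma Lp_imp_locally_integrable:
  fixes f :: "'a::euclidean_space \<Rightarrow> real"
  assumes [measurable]: "f \<in> borel_measurable borel" and "1 \<le> p" "Lp_norm (ennreal p) f < top"
  shows "locally_integrable f"
  unfolding locally_integrable_def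
proof (intro conjI allI assms(1))
  fix R
  have "(\<integral>\<^sup>+x. ennreal (\<bar>f x\<bar> powr p) \<partial>lborel) < top"
    using assms by (auto simp: Lp_norm_ennreal epowr_def top.not_eq_extremum[symmetric] split: if_splits)
  then have i: "integrable lborel (\<lambda>x. \<bar>f x\<bar> powr p)"
    by (intro integrableI_bounded) auto
  have "integrable lborel (\<lambda>x. indicator (ball 0 R) x + \<bar>f x\<bar> powr p)"
    by (intro Bochner_Integration.integrable_add i integrable_real_indicator)
      (auto simp: emeasure_lborel_ball_finite[unfolded infinity_ennreal_def])
  then show "integrable lborel (\<lambda>x. indicator (ball 0 R) x * f x)"
  proof (rule Bochner_Integration.integrable_bound)
    show "AE x in lborel. norm (indicator (ball 0 R) x * f x)
        \<le> norm (indicator (ball 0 R) x + \<bar>f x\<bar> powr p)"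
    proof (intro AE_I2)
      fix x
      have "\<bar>f x\<bar> \<le> 1 + \<bar>f x\<bar> powr p"
      proof (cases "\<bar>f x\<bar> \<le> 1")
        case False
        then have "\<bar>f x\<bar> powr 1 \<le> \<bar>f x\<bar> powr p"
          using assms by (intro powr_mono) auto
        then show ?thesis by simp
      qed (simp add: add_increasing2)
      then show "norm (indicator (ball 0 R) x * f x) \<le> norm (indicator (ball 0 R) x + \<bar>f x\<bar> powr p)"
        by (simp add: indicator_def)
    qed
  qed (use assms(1) in \<open>auto intro!: borel_measurable_times borel_measurable_indicator\<close>)
qed

section \<open>Duality with test functions\<close>

lemma test_functions_cmult:
  "\<psi> \<in> test_functions \<Longrightarrow> (\<lambda>x. c * \<psi> x :: real) \<in> test_functions"
  by (rule test_functions_bounded_linear[OF bounded_linear_mult_right])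

text \<open>Since \<open>bump R\<close> is at least some \<open>c > 0\<close> where \<open>g\<close> lives, \<open>g\<close> is the product of \<open>bump R\<close> and the
  continuous function \<open>u = g / max (bump R) c\<close>. Multiplying a polynomial approximation of \<open>u\<close> by
  \<open>bump R\<close> therefore approximates \<open>g\<close> smoothly and uniformly; a final scaling by \<open>K / (K + d)\<close>
  restores the bound \<open>K\<close> exactly.\<close>

lemma test_function_uniform_approx:
  fixes g :: "'a::euclidean_space \<Rightarrow> real"
  assumes "continuous_on UNIV g" "\<And>x. r \<le> norm x \<Longrightarrow> g x = 0" "\<And>x. \<bar>g x\<bar> \<le> K"
    and "0 < K" "0 < \<delta>" "0 < r"
  obtains \<psi> where "\<psi> \<in> test_functions" "\<And>x. \<bar>\<psi> x\<bar> \<le> K" "\<And>x. \<bar>\<psi> x - g x\<bar> \<le> \<delta>"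
    "\<And>x. r + 1 \<le> norm x \<Longrightarrow> \<psi> x = 0"
proof -
  define R where "R = r + 1"
  define c where "c = flat_exp 0 (R\<^sup>2 - r\<^sup>2)"
  have c: "0 < c" "\<And>x::'a. norm x \<le> r \<Longrightarrow> c \<le> bump R x"
    using bump_lower_bound[where r=r and R=R and 'a='a] bump_lower_bound(1)[of "0::'a" r R] assms(6)
    unfolding c_def R_def by auto
  define u where "u x = g x / max (bump R x) c" for x
  have cont: "continuous_on S u" for S
  proof -
    have "continuous_on UNIV (bump R :: 'a \<Rightarrow> real)"
      using Ck_bump[of 0] by simp
    then have "continuous_on UNIV u"
      unfolding u_def using assms(1) c(1) by (intro continuous_intros) auto
    then show ?thesis by (rule continuous_on_subset) simp
  qed
  have u: "bump R x * u x = g x" for x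
  proof (cases "r \<le> norm x")
    case False
    then have "max (bump R x) c = bump R x" "bump R x \<noteq> 0"
      using c(1) c(2)[of x] by auto
    then show ?thesis by (simp add: u_def)
  qed (simp add: u_def assms(2))
  define d where "d = \<delta> / 2"
  have "0 < d" using assms by (simp add: d_def)
  obtain P where P: "real_polynomial_function P" "\<And>x. x \<in> cball 0 R \<Longrightarrow> \<bar>u x - P x\<bar> < d"
    using Stone_Weierstrass_real_polynomial_function[OF compact_cball cont \<open>0 < d\<close>, of 0 R] by auto
  define h where "h x = bump R x * P x" for x
  have hg: "\<bar>h x - g x\<bar> \<le> d" for x
  proof (cases "norm x \<le> R")
    case True
    have "\<bar>h x - g x\<bar> = bump R x * \<bar>u x - P x\<bar>"
      unfolding h_def u[symmetric]
      by (simp add: abs_mult bump_nonneg abs_minus_commute flip: right_diff_distrib)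
    also have "\<dots> \<le> 1 * d"
      using P(2)[of x] True by (intro mult_mono) (auto simp: bump_nonneg bump_le_1)
    finally show ?thesis by simp
  next
    case False
    then show ?thesis
      using assms(2)[of x] assms(6) \<open>0 < d\<close> by (simp add: h_def bump_outside R_def)
  qed
  have hK: "\<bar>h x\<bar> \<le> K + d" for x
    using hg[of x] assms(3)[of x] by linarith
  define s where "s = K / (K + d)"
  have s: "0 \<le> s" "s * (K + d) = K" "(1 - s) * (K + d) = d" "s \<le> 1"
    using assms \<open>0 < d\<close> by (auto simp: s_def field_simps)
  show thesis
  proof (rule that[of "\<lambda>x. s * h x"])
    have "h \<in> test_functions"
      unfolding test_functions_iff h_def
      using Ck_mult[OF Ck_bump Ck_real_polynomial[OF P(1)]] assms(6)
      by (auto intro!: exI[of _ R] simp: bump_outside R_def)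
    then show "(\<lambda>x. s * h x) \<in> test_functions"
      by (rule test_functions_cmult)
    show "\<bar>s * h x\<bar> \<le> K" for x
      using mult_left_mono[OF hK s(1), of x] s by (simp add: abs_mult)
    show "\<bar>s * h x - g x\<bar> \<le> \<delta>" for x
    proof -
      have "\<bar>s * h x - g x\<bar> \<le> \<bar>h x - g x\<bar> + \<bar>(1 - s) * h x\<bar>"
        by (simp add: left_diff_distrib)
      also have "\<bar>(1 - s) * h x\<bar> \<le> d"
        using mult_left_mono[OF hK, of "1 - s" x] s by (simp add: abs_mult)
      finally show ?thesis
        using hg[of x] by (simp add: d_def)
    qed
    show "s * h x = 0" if "r + 1 \<le> norm x" for x
      using that assms(6) by (simp add: h_def bump_outside R_def)
  qed
qed

text \<open>A Lebesgue measurable function is almost everywhere a limit of continuous functions \<open>H n\<close>;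
  these are clamped to \<open>[-K, K]\<close>, cut off near the sphere of radius \<open>r\<close>, and smoothed. The uniform
  bound and the common support allow dominated convergence.\<close>

lemma test_functions_approx_bounded:
  fixes G :: "'a::euclidean_space \<Rightarrow> real"
  assumes "G \<in> borel_measurable borel" "\<And>x. r \<le> norm x \<Longrightarrow> G x = 0" "\<And>x. \<bar>G x\<bar> \<le> K"
    and "0 < K" "0 < r"
  obtains \<psi> :: "nat \<Rightarrow> 'a \<Rightarrow> real" where "\<And>n. \<psi> n \<in> test_functions" "\<And>n x. \<bar>\<psi> n x\<bar> \<le> K"
    "\<And>n x. r + 1 \<le> norm x \<Longrightarrow> \<psi> n x = 0" "AE x in lborel. (\<lambda>n. \<psi> n x) \<longlonglongrightarrow> G x"
proof -
  have "G \<in> borel_measurable lebesgue"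
    using assms(1) by (simp add: measurable_completion)
  then have "G measurable_on UNIV"
    by (rule lebesgue_measurable_imp_measurable_on) simp
  then obtain N H where N: "negligible N" and H: "\<And>n. continuous_on UNIV (H n)"
      "\<And>x. x \<notin> N \<Longrightarrow> (\<lambda>n. H n x) \<longlonglongrightarrow> G x"
    by (auto simp: measurable_on_def)
  define g where "g n x = min 1 (real n * max 0 (r - norm x)) * max (- K) (min K (H n x))"
    for n :: nat and x
  have g_bound: "\<bar>g n x\<bar> \<le> K" for n x
  proof -
    have "\<bar>g n x\<bar> \<le> 1 * K"
      unfolding g_def abs_mult using assms(4) by (intro mult_mono) auto
    then show ?thesis by simp
  qed
  have "continuous_on UNIV (g n)" for n
    unfolding g_def using H(1) by (intro continuous_intros)
  moreover have "g n x = 0" if "r \<le> norm x" for n x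
    using that by (simp add: g_def)
  ultimately have "\<exists>\<psi>. \<psi> \<in> test_functions \<and> (\<forall>x. \<bar>\<psi> x\<bar> \<le> K)
      \<and> (\<forall>x. \<bar>\<psi> x - g n x\<bar> \<le> inverse (real (Suc n))) \<and> (\<forall>x. r + 1 \<le> norm x \<longrightarrow> \<psi> x = 0)" for n
    using test_function_uniform_approx[of "g n" r K "inverse (real (Suc n))"] g_bound assms(4,5)
    by (metis inverse_positive_iff_positive of_nat_0_less_iff zero_less_Suc)
  then obtain \<psi> where \<psi>: "\<And>n. \<psi> n \<in> test_functions" "\<And>n x. \<bar>\<psi> n x\<bar> \<le> K"
      "\<And>n x. \<bar>\<psi> n x - g n x\<bar> \<le> inverse (real (Suc n))" "\<And>n x. r + 1 \<le> norm x \<Longrightarrow> \<psi> n x = 0"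
    by metis
  have "(\<lambda>n. \<psi> n x) \<longlonglongrightarrow> G x" if "x \<notin> N" for x
  proof -
    have "(\<lambda>n. g n x) \<longlonglongrightarrow> G x"
    proof (cases "r \<le> norm x")
      case True
      then show ?thesis by (simp add: g_def assms(2))
    next
      case False
      obtain m where m: "1 / (r - norm x) \<le> real m"
        using real_arch_simple by blast
      have "min 1 (real n * max 0 (r - norm x)) = 1" if "m \<le> n" for n
      proof -
        have "1 / (r - norm x) \<le> real n"
          using m that by linarith
        then show ?thesis
          using False by (simp add: divide_le_eq)
      qed
      then have "eventually (\<lambda>n. max (- K) (min K (H n x)) = g n x) sequentially"
        unfolding g_def eventually_sequentially by (intro exI[of _ m]) auto
      moreover have "(\<lambda>n. max (- K) (min K (H n x))) \<longlonglongrightarrow> max (- K) (min K (G x))"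
        by (intro tendsto_intros H(2) that)
      moreover have "max (- K) (min K (G x)) = G x"
        using assms(3)[of x] by (auto simp: abs_le_iff max_def min_def)
      ultimately show ?thesis
        using Lim_transform_eventually by fastforce
    qed
    moreover have "(\<lambda>n. \<psi> n x - g n x) \<longlonglongrightarrow> 0"
      by (rule tendsto_rabs_zero_cancel, rule tendsto_sandwich[OF _ _ tendsto_const LIMSEQ_inverse_real_of_nat])
        (use \<psi>(3) in auto)
    ultimately have "(\<lambda>n. (\<psi> n x - g n x) + g n x) \<longlonglongrightarrow> 0 + G x"
      by (intro tendsto_add)
    then show ?thesis by simp
  qed
  then have "AE x in lebesgue. (\<lambda>n. \<psi> n x) \<longlonglongrightarrow> G x"
    using N unfolding negligible_iff_null_sets by (intro AE_I'[of N]) auto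
  with \<psi> show thesis
    by (intro that[of \<psi>]) (auto simp: AE_completion_iff)
qed

lemma integrable_mult_compact_support:
  assumes "locally_integrable F" "g \<in> cont_compact_support"
  shows "integrable lborel (\<lambda>x. g x * F x)"
proof -
  obtain R where R: "0 < R" "\<And>x. R \<le> norm x \<Longrightarrow> g x = 0"
    using cont_compact_supportE[OF assms(2)] by blast
  obtain B where B: "0 < B" "\<And>x. \<bar>g x\<bar> \<le> B"
    using cont_compact_support_bounded[OF assms(2)] by blast
  have "integrable lborel (\<lambda>x. B * (indicator (ball 0 R) x * F x))"
    by (intro integrable_mult_right locally_integrableD assms(1))
  then show ?thesis
  proof (rule Bochner_Integration.integrable_bound)
    show "(\<lambda>x. g x * F x) \<in> borel_measurable lborel"
      using cont_compact_support_measurable[OF assms(2)] locally_integrableD(1)[OF assms(1)] by simp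
    show "AE x in lborel. norm (g x * F x) \<le> norm (B * (indicator (ball 0 R) x * F x))"
    proof (rule AE_I2)
      fix x
      show "norm (g x * F x) \<le> norm (B * (indicator (ball 0 R) x * F x))"
        using R(2)[of x] B by (cases "R \<le> norm x") (auto simp: abs_mult mult_right_mono)
    qed
  qed
qed

text \<open>The bound below is the truncated form of the duality between \<open>L\<^sup>p\<close> and \<open>L\<^sup>q\<close>: the extremal
  function \<open>sgn F \<cdot> \<bar>F\<bar>\<^sup>p\<^sup>-\<^sup>1\<close> is cut down to a bounded function of bounded support, and then
  approximated by test functions.\<close>

lemma truncated_duality:
  fixes F :: "'a::euclidean_space \<Rightarrow> real"
  assumes F: "locally_integrable F"
    and p: "1 \<le> p" and "0 \<le> M" and N: "1 \<le> N"
    and dual: "\<And>\<psi>. \<psi> \<in> test_functions \<Longrightarrow> Lp_norm (conj_exponent p) \<psi> \<le> 1 \<Longrightarrow>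
      (\<integral>x. \<psi> x * F x \<partial>lborel) \<le> M"
  defines "E \<equiv> {x. norm x < N \<and> \<bar>F x\<bar> \<le> N}"
  shows "(\<integral>\<^sup>+x. ennreal (indicator E x * \<bar>F x\<bar> powr p) \<partial>lborel) \<le> ennreal (M powr p)"
proof -
  note [measurable] = locally_integrableD(1)[OF F]
  have E [measurable]: "E \<in> sets borel"
    unfolding E_def by measurable
  define G where "G x = indicator E x * (sgn (F x) * \<bar>F x\<bar> powr (p - 1))" for x
  \<comment> \<open>A bound for \<open>G\<close>. For \<open>p = 1\<close> it equals 1, so the approximants of \<open>G\<close> need no normalization.\<close>
  define K where "K = N powr (p - 1)"
  have "0 < K" using N by (simp add: K_def)
  have [measurable]: "G \<in> borel_measurable borel"
    unfolding G_def by measurable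
  have G_bound: "\<bar>G x\<bar> \<le> K" for x
  proof (cases "x \<in> E")
    case True
    have "\<bar>G x\<bar> \<le> \<bar>F x\<bar> powr (p - 1)"
      using True by (auto simp: G_def abs_mult sgn_if)
    also have "\<dots> \<le> K"
      using True p unfolding K_def E_def by (intro powr_mono2) auto
    finally show ?thesis .
  qed (use \<open>0 < K\<close> in \<open>simp add: G_def\<close>)
  have G_supp: "G x = 0" if "N \<le> norm x" for x
    using that by (simp add: G_def E_def)
  have GF: "G x * F x = indicator E x * \<bar>F x\<bar> powr p" for x
  proof -
    have "\<bar>F x\<bar> * \<bar>F x\<bar> powr (p - 1) = \<bar>F x\<bar> powr p"
      using powr_mult_base[of "\<bar>F x\<bar>" "p - 1"] p by (cases "F x = 0") auto
    moreover have "sgn (F x) * F x = \<bar>F x\<bar>"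
      by (simp add: sgn_if)
    ultimately show ?thesis
      unfolding G_def by (metis (no_types, opaque_lifting) mult.assoc mult.commute)
  qed
  obtain \<psi> where \<psi>: "\<And>n. \<psi> n \<in> test_functions" "\<And>n x. \<bar>\<psi> n x\<bar> \<le> K"
    "\<And>n x. N + 1 \<le> norm x \<Longrightarrow> \<psi> n x = 0" "AE x in lborel. (\<lambda>n. \<psi> n x) \<longlonglongrightarrow> G x"
    using test_functions_approx_bounded[of G N K] G_bound G_supp \<open>0 < K\<close> N by auto
  have \<psi>_cc: "\<psi> n \<in> cont_compact_support" for n
    using \<psi>(1) by (rule test_functions_cont_compact_support)
  have [measurable]: "\<psi> n \<in> borel_measurable borel" for n
    using \<psi>_cc by (rule cont_compact_support_measurable)
  have ball_fin: "emeasure lborel (ball (0::'a) R) < \<infinity>" for R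
    by (rule emeasure_lborel_ball_finite)
  have ball_int: "integrable lborel (\<lambda>x::'a. c * indicator (ball 0 R) x)" for R and c :: real
    using ball_fin[of R] by (intro integrable_mult_right integrable_real_indicator) auto
  define I where "I = (\<integral>x. G x * F x \<partial>lborel)"
  have GF_int: "integrable lborel (\<lambda>x. G x * F x)"
  proof (rule Bochner_Integration.integrable_bound[OF ball_int[of "N powr p" N]])
    have "\<bar>G x * F x\<bar> \<le> N powr p * indicator (ball 0 N) x" for x
      unfolding GF using p by (auto simp: E_def indicator_def intro!: powr_mono2)
    then show "AE x in lborel. norm (G x * F x) \<le> norm (N powr p * indicator (ball 0 N) x)"
      by (intro AE_I2) (simp add: abs_mult)
  qed measurable
  have lim: "(\<lambda>n. \<integral>x. \<psi> n x * F x \<partial>lborel) \<longlonglongrightarrow> I"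
    unfolding I_def
  proof (rule integral_dominated_convergence[where w="\<lambda>x. K * \<bar>indicator (ball 0 (N + 1)) x * F x\<bar>"])
    show "integrable lborel (\<lambda>x. K * \<bar>indicator (ball 0 (N + 1)) x * F x\<bar>)"
      by (intro integrable_mult_right integrable_abs locally_integrableD(2)[OF F])
    show "AE x in lborel. (\<lambda>n. \<psi> n x * F x) \<longlonglongrightarrow> G x * F x"
      using \<psi>(4) by eventually_elim (intro tendsto_intros)
    show "AE x in lborel. norm (\<psi> n x * F x) \<le> K * \<bar>indicator (ball 0 (N + 1)) x * F x\<bar>" for n
    proof (rule AE_I2)
      fix x
      show "norm (\<psi> n x * F x) \<le> K * \<bar>indicator (ball 0 (N + 1)) x * F x\<bar>"
        using \<psi>(2)[of n x] \<psi>(3)[of x n] by (cases "N + 1 \<le> norm x") (auto simp: abs_mult mult_right_mono \<psi>(3))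
    qed
  qed measurable
  have "0 \<le> I"
    unfolding I_def GF by (rule Bochner_Integration.integral_nonneg) auto
  have "I \<le> M powr p"
    using p
  proof (cases rule: conj_exponent_cases)
    case 1
    have "Lp_norm (conj_exponent p) (\<psi> n) \<le> 1" for n
      using Lp_norm_top_leI[of "\<psi> n" 1] \<psi>(2)[of n] 1 N by (simp add: K_def)
    then have "(\<integral>x. \<psi> n x * F x \<partial>lborel) \<le> M" for n
      by (intro dual \<psi>(1))
    then have "I \<le> M"
      by (intro LIMSEQ_le_const2[OF lim]) auto
    then show ?thesis
      using 1 \<open>0 \<le> M\<close> by simp
  next
    case (2 q)
    define a where "a n = (\<integral>x. \<bar>\<psi> n x\<bar> powr q \<partial>lborel)" for n
    have pq: "(p - 1) * q = p"
      using 2 by (simp add: field_simps)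
    have "\<bar>G x\<bar> powr q = indicator E x * \<bar>F x\<bar> powr p" for x
      using pq by (auto simp: G_def abs_mult powr_powr sgn_if indicator_def)
    then have I_eq: "I = (\<integral>x. \<bar>G x\<bar> powr q \<partial>lborel)"
      unfolding I_def GF by simp
    have \<psi>_dom: "\<bar>\<psi> n x\<bar> powr q \<le> K powr q * indicator (ball 0 (N + 1)) x" for n x
      using \<psi>(2)[of n x] \<psi>(3)[of x n] 2
      by (cases "N + 1 \<le> norm x") (auto intro!: powr_mono2)
    have \<psi>_int: "integrable lborel (\<lambda>x. \<bar>\<psi> n x\<bar> powr q)" for n
      by (rule Bochner_Integration.integrable_bound[OF ball_int[of "K powr q" "N + 1"]])
        (use \<psi>_dom in \<open>auto intro!: AE_I2 simp: abs_mult\<close>)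
    have a_lim: "a \<longlonglongrightarrow> I"
      unfolding a_def I_eq
    proof (rule integral_dominated_convergence[OF _ _ ball_int[of "K powr q" "N + 1"]])
      show "AE x in lborel. (\<lambda>n. \<bar>\<psi> n x\<bar> powr q) \<longlonglongrightarrow> \<bar>G x\<bar> powr q"
        using \<psi>(4)
      proof eventually_elim
        case (elim x)
        then show ?case
          using 2 by (intro tendsto_powr' tendsto_intros) auto
      qed
      show "AE x in lborel. norm (\<bar>\<psi> n x\<bar> powr q) \<le> K powr q * indicator (ball 0 (N + 1)) x" for n
        using \<psi>_dom by (intro AE_I2) simp
    qed measurable
    have a0: "0 \<le> a n" for n
      unfolding a_def by (rule Bochner_Integration.integral_nonneg) simp
    \<comment> \<open>\<open>c n\<close> exceeds the \<open>L\<^sup>q\<close>-norm of \<open>\<psi> n\<close>; the second summand keeps it positive.\<close>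
    define c where "c n = a n powr (1 / q) + inverse (real (Suc n))" for n
    have c0: "0 < c n" for n
      unfolding c_def by (intro add_nonneg_pos) auto
    have "(\<integral>x. \<psi> n x * F x \<partial>lborel) \<le> M * c n" for n
    proof -
      have "(\<integral>\<^sup>+x. ennreal (norm (\<psi> n x) powr q) \<partial>lborel) = ennreal (a n)"
        unfolding a_def using nn_integral_eq_integral[OF \<psi>_int[of n]] by simp
      then have "Lp_norm (conj_exponent p) (\<psi> n) = ennreal (a n powr (1 / q))"
        using 2 a0 by (simp add: Lp_norm_ennreal epowr_ennreal)
      also have "\<dots> \<le> ennreal (c n)"
        unfolding c_def by (intro ennreal_leI) simp
      finally have "Lp_norm (conj_exponent p) (\<lambda>x. 1 / c n * \<psi> n x) \<le> ennreal (1 / c n * c n)"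
        using p c0[of n] \<psi>_cc by (intro Lp_norm_cmult_le) auto
      then have "(\<integral>x. (1 / c n * \<psi> n x) * F x \<partial>lborel) \<le> M"
        using c0[of n] by (intro dual test_functions_cmult \<psi>(1)) simp
      moreover have "(\<integral>x. (1 / c n * \<psi> n x) * F x \<partial>lborel) = 1 / c n * (\<integral>x. \<psi> n x * F x \<partial>lborel)"
        unfolding mult.assoc by (rule integral_mult_right_zero)
      ultimately show ?thesis
        using c0[of n] by (simp add: divide_le_eq)
    qed
    moreover have "(\<lambda>n. M * c n) \<longlonglongrightarrow> M * (I powr (1 / q) + 0)"
      unfolding c_def using 2 a0
      by (intro tendsto_intros tendsto_powr' a_lim LIMSEQ_inverse_real_of_nat) auto
    ultimately have le: "I \<le> M * I powr (1 / q)"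
      using LIMSEQ_le[OF lim] by fastforce
    show ?thesis
    proof (cases "I = 0")
      case False
      then have "0 < I" using \<open>0 \<le> I\<close> by simp
      have "I powr (1 / p) * I powr (1 / q) = I"
        using 2 \<open>0 < I\<close> by (simp flip: powr_add)
      with le have "I powr (1 / p) \<le> M"
        using \<open>0 < I\<close> by (metis mult_le_cancel_right_pos powr_gt_zero less_irrefl)
      then have "(I powr (1 / p)) powr p \<le> M powr p"
        using p by (intro powr_mono2) auto
      then show ?thesis
        using p \<open>0 < I\<close> by (simp add: powr_powr)
    qed simp
  qed
  moreover have "(\<integral>\<^sup>+x. ennreal (indicator E x * \<bar>F x\<bar> powr p) \<partial>lborel) = ennreal I"
    using nn_integral_eq_integral[OF GF_int] unfolding I_def GF by simp
  ultimately show ?thesis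
    by (simp add: ennreal_leI)
qed

lemma Lp_norm_le_dual:
  fixes F :: "'a::euclidean_space \<Rightarrow> real"
  assumes F: "locally_integrable F"
    and "1 \<le> p" "0 \<le> M"
    and "\<And>\<psi>. \<psi> \<in> test_functions \<Longrightarrow> Lp_norm (conj_exponent p) \<psi> \<le> 1 \<Longrightarrow>
      (\<integral>x. \<psi> x * F x \<partial>lborel) \<le> M"
  shows "Lp_norm (ennreal p) F \<le> ennreal M"
proof -
  note [measurable] = locally_integrableD(1)[OF F]
  \<comment> \<open>The truncations of \<^term>\<open>\<lambda>x. \<bar>F x\<bar> powr p\<close> increase to it, and their integrals are bounded.\<close>
  define E where "E n = {x. norm x < real (Suc n) \<and> \<bar>F x\<bar> \<le> real (Suc n)}" for n
  define u where "u n x = ennreal (indicator (E n) x * \<bar>F x\<bar> powr p)" for n x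
  have [measurable]: "E n \<in> sets borel" for n
    unfolding E_def by measurable
  have "(\<lambda>n. \<integral>\<^sup>+x. u n x \<partial>lborel) \<longlonglongrightarrow> (\<integral>\<^sup>+x. ennreal (\<bar>F x\<bar> powr p) \<partial>lborel)"
  proof (rule nn_integral_LIMSEQ)
    have "indicator (E m) x \<le> (indicator (E n) x :: real)" if "m \<le> n" for m n x
      using that by (intro indicator_leI) (auto simp: E_def)
    then show "incseq u"
      by (auto simp: incseq_def le_fun_def u_def intro!: ennreal_leI mult_right_mono)
    show "u n \<in> borel_measurable lborel" for n
      unfolding u_def by measurable
    show "(\<lambda>n. u n x) \<longlonglongrightarrow> ennreal (\<bar>F x\<bar> powr p)" for x
    proof -
      obtain m where m: "max (norm x) \<bar>F x\<bar> < real m"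
        using reals_Archimedean2 by blast
      have "ennreal (\<bar>F x\<bar> powr p) = u n x" if "m \<le> n" for n
      proof -
        have "x \<in> E n" using m that by (simp add: E_def)
        then show ?thesis by (simp add: u_def)
      qed
      then show ?thesis
        by (intro Lim_transform_eventually[OF tendsto_const])
          (auto simp: eventually_sequentially)
    qed
  qed
  moreover have "(\<integral>\<^sup>+x. u n x \<partial>lborel) \<le> ennreal (M powr p)" for n
    unfolding u_def E_def using assms by (intro truncated_duality) auto
  ultimately have "(\<integral>\<^sup>+x. ennreal (\<bar>F x\<bar> powr p) \<partial>lborel) \<le> ennreal (M powr p)"
    by (intro LIMSEQ_le_const2) auto
  then show ?thesis
    using assms by (simp add: Lp_norm_le_iff)
qed

section \<open>Pairing with differences and averages\<close>

context
  fixes f :: "real^'n \<Rightarrow> real"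
  assumes loc: "locally_integrable f"
begin

lemmas measurable_f [measurable] = locally_integrableD(1)[OF loc]

lemmas integrable_on_balls = locally_integrableD(2)[OF loc]

lemmas integrable_mult = integrable_mult_compact_support[OF loc]

lemma integrable_translate_mult:
  assumes "g \<in> cont_compact_support"
  shows "integrable lborel (\<lambda>x. g x * f (x - v))"
proof -
  have "integrable lborel (\<lambda>x. g (x + v) * f x)"
    by (intro integrable_mult cont_compact_support_translate assms)
  from integrable_lborel_translate[OF this, of "- v"] show ?thesis by simp
qed

lemma integral_difference_mult:
  assumes "g \<in> cont_compact_support"
  shows "(\<integral>x. (g (x + v) - g x) * f x \<partial>lborel) = (\<integral>x. (f (x - v) - f x) * g x \<partial>lborel)"
proof -
  have [measurable]: "g \<in> borel_measurable borel"
    using assms by (rule cont_compact_support_measurable)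
  have "(\<integral>x. (g (x + v) - g x) * f x \<partial>lborel)
      = (\<integral>x. g (x + v) * f x \<partial>lborel) - (\<integral>x. g x * f x \<partial>lborel)"
    unfolding left_diff_distrib
    by (intro Bochner_Integration.integral_diff integrable_mult cont_compact_support_translate assms)
  also have "(\<integral>x. g (x + v) * f x \<partial>lborel) = (\<integral>x. g x * f (x - v) \<partial>lborel)"
    using integral_lborel_translate[of "\<lambda>x. g (x + v) * f x" "-v"] by simp
  also have "\<dots> - (\<integral>x. g x * f x \<partial>lborel) = (\<integral>x. g x * f (x - v) - g x * f x \<partial>lborel)"
    by (intro Bochner_Integration.integral_diff[symmetric] integrable_mult integrable_translate_mult assms)
  finally show ?thesis
    by (simp add: algebra_simps)
qed

lemma locally_integrable_difference: "locally_integrable (\<lambda>x. f (x - v) - f x)"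
  unfolding locally_integrable_def
proof (intro conjI allI)
  fix R
  have "integrable lborel (\<lambda>x. indicator (ball 0 (R + norm v)) (x + - v) * f (x + - v))"
    using integrable_lborel_translate[OF integrable_on_balls[of "R + norm v"], of "- v"] .
  then have "integrable lborel (\<lambda>x. indicator (ball 0 R) x * f (x - v))"
  proof (rule Bochner_Integration.integrable_bound)
    show "AE x in lborel. norm (indicator (ball 0 R) x * f (x - v))
        \<le> norm (indicator (ball 0 (R + norm v)) (x + - v) * f (x + - v))"
    proof (rule AE_I2)
      fix x
      have "norm (x - v) < R + norm v" if "norm x < R"
        using norm_triangle_ineq4[of x v] that by linarith
      then show "norm (indicator (ball 0 R) x * f (x - v))
          \<le> norm (indicator (ball 0 (R + norm v)) (x + - v) * f (x + - v))"
        by (auto simp: indicator_def)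
    qed
  qed (auto intro!: borel_measurable_times borel_measurable_indicator)
  then show "integrable lborel (\<lambda>x. indicator (ball 0 R) x * (f (x - v) - f x))"
    unfolding right_diff_distrib by (intro Bochner_Integration.integrable_diff integrable_on_balls)
qed simp

text \<open>The basic estimate: pairing \<open>f\<close> with a difference of \<open>g\<close> is pairing a difference of \<open>f\<close>
  with \<open>g\<close>, to which Hoelder's inequality applies.\<close>

lemma pairing_difference_le:
  assumes "1 \<le> p" "g \<in> cont_compact_support" "0 < d" "Lp_norm (conj_exponent p) g \<le> ennreal d"
    and "norm v \<le> \<epsilon>"
  shows "ennreal \<bar>\<integral>x. (g (x + v) - g x) * f x \<partial>lborel\<bar> \<le> omega_p p f \<epsilon> * ennreal d"
  unfolding integral_difference_mult[OF assms(2)]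
proof (rule Hoelder)
  show "Lp_norm (ennreal p) (\<lambda>x. f (x - v) - f x) \<le> omega_p p f \<epsilon>"
    unfolding omega_p_def using assms by (intro SUP_upper2[of v]) auto
qed (use assms in \<open>auto intro: cont_compact_support_measurable\<close>)

text \<open>By Fubini's theorem, the pairing with \<open>A\<^sub>v g - g\<close> is the mean over \<open>0 \<le> t \<le> 1\<close> of the pairings
  with \<open>g(\<sqdot> + t v) - g\<close>.\<close>

lemma pairing_line_avg_le:
  assumes "1 \<le> p" "g \<in> cont_compact_support" "0 < d" "Lp_norm (conj_exponent p) g \<le> ennreal d"
    and "norm v \<le> \<epsilon>"
  shows "ennreal \<bar>\<integral>x. (line_avg v g x - g x) * f x \<partial>lborel\<bar> \<le> omega_p p f \<epsilon> * ennreal d"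
proof -
  note cont = cont_compact_support_continuous[OF assms(2)]
  have g [measurable]: "g \<in> borel_measurable borel"
    using assms(2) by (rule cont_compact_support_measurable)
  obtain R where R: "0 < R" "\<And>x. R \<le> norm x \<Longrightarrow> g x = 0"
    using cont_compact_supportE[OF assms(2)] by blast
  obtain B where B: "0 < B" "\<And>x. \<bar>g x\<bar> \<le> B"
    using cont_compact_support_bounded[OF assms(2)] by blast
  \<comment> \<open>\<open>k\<close> is the integrand of the double integral, and \<open>w\<close> an integrable majorant in \<open>x\<close>.\<close>
  define k where "k t x = indicator {0..1::real} t * ((g (x + t *\<^sub>R v) - g x) * f x)" for t x
  define w where "w x = 2 * B * \<bar>indicator (ball 0 (R + norm v)) x * f x\<bar>" for x
  have w_int: "integrable lborel w"
    unfolding w_def by (intro integrable_mult_right integrable_abs integrable_on_balls)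
  have w_meas [measurable]: "w \<in> borel_measurable borel"
    using borel_measurable_integrable[OF w_int] by simp
  have w0: "0 \<le> w x" for x
    using B by (simp add: w_def)
  have k_le: "\<bar>k t x\<bar> \<le> indicator {0..1} t * w x" for t x
  proof (cases "t \<in> {0..1}")
    case True
    have "\<bar>(g (x + t *\<^sub>R v) - g x) * f x\<bar> \<le> w x"
    proof (cases "R + norm v \<le> norm x")
      case far: True
      have "norm (t *\<^sub>R v) \<le> norm v"
        using True by (simp add: mult_left_le_one_le)
      then have "R \<le> norm (x + t *\<^sub>R v)"
        using norm_triangle_ineq4[of "x + t *\<^sub>R v" "t *\<^sub>R v"] far by simp
      moreover have "R \<le> norm x"
        using far norm_ge_zero[of v] by linarith
      ultimately show ?thesis
        using R(2) w0 by simp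
    next
      case False
      have "\<bar>g (x + t *\<^sub>R v) - g x\<bar> \<le> 2 * B"
        using B(2)[of x] B(2)[of "x + t *\<^sub>R v"] by linarith
      then show ?thesis
        using False by (simp add: w_def abs_mult mult_right_mono)
    qed
    then show ?thesis
      using True by (simp add: k_def)
  qed (simp add: k_def)
  have "integrable (lborel \<Otimes>\<^sub>M lborel) (\<lambda>(t, x). indicator {0..1::real} t * w x)"
  proof (rule lborel_pair.Fubini_integrable)
    show "(\<lambda>(t, x). indicator {0..1::real} t * w x) \<in> borel_measurable (lborel \<Otimes>\<^sub>M lborel)"
      by measurable
    show "integrable lborel
        (\<lambda>t::real. \<integral>x. norm (case (t, x) of (t, x) \<Rightarrow> indicator {0..1} t * w x) \<partial>lborel)"
      using w0 by (simp add: abs_mult)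
    show "AE t in lborel. integrable lborel
        (\<lambda>x. case (t::real, x) of (t, x) \<Rightarrow> indicator {0..1} t * w x)"
      using w_int by simp
  qed
  then have k_int: "integrable (lborel \<Otimes>\<^sub>M lborel) (case_prod k)"
  proof (rule Bochner_Integration.integrable_bound)
    show "case_prod k \<in> borel_measurable (lborel \<Otimes>\<^sub>M lborel)"
      unfolding k_def by measurable
    show "AE z in lborel \<Otimes>\<^sub>M lborel. norm (case_prod k z)
        \<le> norm (case z of (t, x) \<Rightarrow> indicator {0..1::real} t * w x)"
    proof (rule AE_I2)
      fix z :: "real \<times> (real^'n)"
      show "norm (case_prod k z) \<le> norm (case z of (t, x) \<Rightarrow> indicator {0..1::real} t * w x)"
        using k_le[of "fst z" "snd z"] w0[of "snd z"] by (simp add: case_prod_beta abs_mult)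
    qed
  qed
  have "(line_avg v g x - g x) * f x = (\<integral>t. k t x \<partial>lborel)" for x
  proof -
    have "set_integrable lborel {0..1} (\<lambda>t. g (x + t *\<^sub>R v) - g x)"
      by (intro borel_integrable_atLeastAtMost' continuous_intros continuous_on_along_segment cont)
    from set_borel_integral_eq_integral(2)[OF this]
    have "(\<integral>t. indicator {0..1} t * (g (x + t *\<^sub>R v) - g x) \<partial>lborel)
        = integral {0..1} (\<lambda>t. g (x + t *\<^sub>R v) - g x)"
      by (simp add: set_lebesgue_integral_def)
    also have "\<dots> = line_avg v g x - g x"
      unfolding line_avg_def by (subst integral_diff) (auto intro: integrable_along_segment[OF cont])
    finally show ?thesis
      unfolding k_def mult.assoc[symmetric] by simp
  qed
  then have "(\<integral>x. (line_avg v g x - g x) * f x \<partial>lborel) = (\<integral>x. (\<integral>t. k t x \<partial>lborel) \<partial>lborel)"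
    by simp
  also have "\<dots> = (\<integral>t. (\<integral>x. k t x \<partial>lborel) \<partial>lborel)"
    by (rule lborel_pair.Fubini_integral[OF k_int])
  finally have "ennreal \<bar>\<integral>x. (line_avg v g x - g x) * f x \<partial>lborel\<bar>
      \<le> (\<integral>\<^sup>+t. ennreal \<bar>\<integral>x. k t x \<partial>lborel\<bar> \<partial>lborel)"
    by (simp add: ennreal_abs_integral_le)
  also have "\<dots> \<le> (\<integral>\<^sup>+t. omega_p p f \<epsilon> * ennreal d * indicator {0..1::real} t \<partial>lborel)"
  proof (rule nn_integral_mono)
    fix t :: real
    show "ennreal \<bar>\<integral>x. k t x \<partial>lborel\<bar> \<le> omega_p p f \<epsilon> * ennreal d * indicator {0..1::real} t"
    proof (cases "t \<in> {0..1}")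
      case True
      then have "norm (t *\<^sub>R v) \<le> norm v"
        by (simp add: mult_left_le_one_le)
      then have "norm (t *\<^sub>R v) \<le> \<epsilon>"
        using assms(5) by (rule order_trans)
      from pairing_difference_le[OF assms(1-4) this] show ?thesis
        using True by (simp add: k_def)
    qed (simp add: k_def)
  qed
  also have "\<dots> = omega_p p f \<epsilon> * ennreal d"
    by (simp add: nn_integral_cmult)
  finally show ?thesis .
qed

end

text \<open>The composition of the averages along the vectors of a list.\<close>

definition line_avgs :: "'a::euclidean_space list \<Rightarrow> ('a \<Rightarrow> real) \<Rightarrow> 'a \<Rightarrow> real" where
  "line_avgs vs = foldr line_avg vs"

lemma line_avgs_simps [simp]:
  "line_avgs [] g = g" "line_avgs (v # vs) g = line_avg v (line_avgs vs g)"
  by (simp_all add: line_avgs_def)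

lemma line_avgs_cont_compact_support:
  "g \<in> cont_compact_support \<Longrightarrow> line_avgs vs g \<in> cont_compact_support"
  by (induction vs) (auto intro: line_avg_cont_compact_support)

lemma Lp_norm_line_avgs_le:
  assumes "1 \<le> p" "g \<in> cont_compact_support" "0 \<le> c" "Lp_norm (conj_exponent p) g \<le> ennreal c"
  shows "Lp_norm (conj_exponent p) (line_avgs vs g) \<le> ennreal c"
  by (induction vs) (auto intro: Lp_norm_line_avg_le line_avgs_cont_compact_support assms)

lemma line_avgs_sum:
  assumes "finite I" "\<And>i. i \<in> I \<Longrightarrow> g i \<in> cont_compact_support"
  shows "line_avgs vs (\<lambda>x. \<Sum>i\<in>I. g i x) = (\<lambda>x. \<Sum>i\<in>I. line_avgs vs (g i) x)"
  by (induction vs)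
    (auto simp: line_avg_sum assms cont_compact_support_continuous line_avgs_cont_compact_support)

lemma line_avgs_cmult: "line_avgs vs (\<lambda>x. c * g x) = (\<lambda>x. c * line_avgs vs g x)"
  by (induction vs) (auto simp: line_avg_cmult)

lemma line_avgs_difference:
  assumes "g \<in> cont_compact_support"
  shows "line_avgs vs (\<lambda>x. g (x + v) - g x) = (\<lambda>x. line_avgs vs g (x + v) - line_avgs vs g x)"
proof (induction vs)
  case (Cons w vs)
  have c: "line_avgs vs g \<in> cont_compact_support"
    using assms by (rule line_avgs_cont_compact_support)
  show ?case
    by (simp add: Cons line_avg_diff line_avg_translate cont_compact_support_continuous
        cont_compact_support_translate c)
qed simp

lemma line_avg_line_avgs:
  assumes "g \<in> cont_compact_support"
  shows "line_avg v (line_avgs vs g) = line_avgs vs (line_avg v g)"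
proof (induction vs)
  case (Cons w vs)
  have "line_avg v (line_avg w (line_avgs vs g)) = line_avg w (line_avg v (line_avgs vs g))"
    by (intro line_avg_commute cont_compact_support_continuous line_avgs_cont_compact_support assms)
  with Cons show ?case by simp
qed simp

lemma line_avgs_remove1:
  assumes "g \<in> cont_compact_support" "v \<in> set vs"
  shows "line_avgs vs g = line_avgs (remove1 v vs) (line_avg v g)"
  using assms(2)
proof (induction vs)
  case (Cons w vs)
  then show ?case
    using line_avg_line_avgs[OF assms(1)] by (cases "v = w") auto
qed simp

lemma divergence_cont_compact_support:
  fixes \<Phi> :: "real^'n \<Rightarrow> real^'n"
  assumes "\<Phi> \<in> test_functions"
  shows "divergence \<Phi> \<in> cont_compact_support"
  unfolding divergence_def
  by (intro cont_compact_support_sum test_functions_cont_compact_support dir_deriv_test_functions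
      test_functions_bounded_linear[OF bounded_linear_vec_nth] assms) simp

context
  fixes f :: "real^'n \<Rightarrow> real"
  assumes loc: "locally_integrable f"
begin

text \<open>The averages are inserted one at a time; each costs at most \<open>\<omega>(\<epsilon>) d\<close>, because the averages
  already inserted do not increase the \<open>L\<^sup>q\<close>-norm.\<close>

lemma pairing_line_avgs_le:
  assumes "1 \<le> p" "g \<in> cont_compact_support" "0 < d" "Lp_norm (conj_exponent p) g \<le> ennreal d"
    and "\<And>v. v \<in> set vs \<Longrightarrow> norm v \<le> \<epsilon>"
  shows "ennreal \<bar>\<integral>x. (line_avgs vs g x - g x) * f x \<partial>lborel\<bar>
    \<le> of_nat (length vs) * (omega_p p f \<epsilon> * ennreal d)"
  using assms(5)
proof (induction vs)
  case (Cons v vs)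
  define h where "h = line_avgs vs g"
  have h: "h \<in> cont_compact_support" "Lp_norm (conj_exponent p) h \<le> ennreal d"
    using assms unfolding h_def
    by (auto intro: line_avgs_cont_compact_support Lp_norm_line_avgs_le)
  have i: "integrable lborel (\<lambda>x. (line_avg v h x - h x) * f x)"
    "integrable lborel (\<lambda>x. (h x - g x) * f x)"
    by (intro integrable_mult[OF loc] cont_compact_support_diff line_avg_cont_compact_support h assms)+
  have "(\<integral>x. (line_avg v h x - g x) * f x \<partial>lborel)
      = (\<integral>x. (line_avg v h x - h x) * f x \<partial>lborel) + (\<integral>x. (h x - g x) * f x \<partial>lborel)"
    by (subst Bochner_Integration.integral_add[OF i, symmetric]) (simp add: algebra_simps)
  then have "ennreal \<bar>\<integral>x. (line_avg v h x - g x) * f x \<partial>lborel\<bar>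
      \<le> ennreal \<bar>\<integral>x. (line_avg v h x - h x) * f x \<partial>lborel\<bar> + ennreal \<bar>\<integral>x. (h x - g x) * f x \<partial>lborel\<bar>"
    by (simp add: ennreal_leI flip: ennreal_plus)
  also have "\<dots> \<le> omega_p p f \<epsilon> * ennreal d + of_nat (length vs) * (omega_p p f \<epsilon> * ennreal d)"
    using Cons assms h by (intro add_mono pairing_line_avg_le[OF loc]) (auto simp: h_def)
  finally show ?case
    by (simp add: h_def distrib_right)
qed simp

text \<open>When \<open>v\<close> is among the averaging directions, its average is applied first and turns
  \<open>\<partial>\<^sub>v \<phi>\<close> into the difference \<open>\<phi>(\<sqdot> + v) - \<phi>\<close>.\<close>

lemma pairing_line_avgs_dir_deriv_le:
  assumes "1 \<le> p" "\<phi> \<in> test_functions" "0 < d" "Lp_norm (conj_exponent p) \<phi> \<le> ennreal d"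
    and "v \<in> set vs" "norm v \<le> \<epsilon>"
  shows "ennreal \<bar>\<integral>x. line_avgs vs (dir_deriv v \<phi>) x * f x \<partial>lborel\<bar> \<le> omega_p p f \<epsilon> * ennreal d"
proof -
  have c: "\<phi> \<in> cont_compact_support" "dir_deriv v \<phi> \<in> cont_compact_support"
    using assms(2) by (auto intro: test_functions_cont_compact_support dir_deriv_test_functions)
  define h where "h = line_avgs (remove1 v vs) \<phi>"
  have "line_avg v (dir_deriv v \<phi>) = (\<lambda>x. \<phi> (x + v) - \<phi> x)"
    using line_avg_dir_deriv[OF assms(2)] by blast
  then have "line_avgs vs (dir_deriv v \<phi>) = (\<lambda>x. h (x + v) - h x)"
    by (simp add: line_avgs_remove1[OF c(2) assms(5)] line_avgs_difference c h_def)
  then show ?thesis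
    using assms c unfolding h_def
    by (auto intro!: pairing_difference_le[OF loc] line_avgs_cont_compact_support Lp_norm_line_avgs_le)
qed

section \<open>Comparison of the three moduli\<close>

lemma integral_lebesgue_test:
  "\<phi> \<in> cont_compact_support \<Longrightarrow> (\<integral>x. \<phi> x * f x \<partial>lebesgue) = (\<integral>x. \<phi> x * f x \<partial>lborel)"
  using borel_measurable_times[OF cont_compact_support_measurable locally_integrableD(1)[OF loc]]
  by (simp add: integral_completion)

lemma sigma_p_le_omega_p:
  assumes "1 \<le> p" "0 < \<epsilon>"
  shows "sigma_p p f \<epsilon> \<le> ennreal (2 * real CARD('n)) * omega_p p f \<epsilon>"
  unfolding sigma_p_def
proof (rule SUP_least, clarify)
  fix \<Phi> :: "real^'n \<Rightarrow> real^'n"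
  assume \<Phi>: "\<Phi> \<in> test_functions" "Lp_norm (conj_exponent p) (divergence \<Phi>) \<le> 1"
    "Lp_norm (conj_exponent p) \<Phi> \<le> ennreal \<epsilon>"
  define \<phi> where "\<phi> i x = \<Phi> x $ i" for i x
  define \<W> where "\<W> = omega_p p f \<epsilon>"
  have \<phi>: "\<phi> i \<in> test_functions" for i
    unfolding \<phi>_def by (rule test_functions_bounded_linear[OF bounded_linear_vec_nth \<Phi>(1)])
  define g where "g i = dir_deriv (axis i 1) (\<phi> i)" for i
  have g: "g i \<in> cont_compact_support" for i
    unfolding g_def by (intro test_functions_cont_compact_support dir_deriv_test_functions \<phi>)
  have div: "divergence \<Phi> = (\<lambda>x. \<Sum>i\<in>UNIV. g i x)"
    by (simp add: divergence_def[abs_def] g_def \<phi>_def[abs_def])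
  define D where "D = divergence \<Phi>"
  have D: "D \<in> cont_compact_support"
    unfolding D_def using \<Phi>(1) by (rule divergence_cont_compact_support)
  obtain js :: "'n list" where js: "set js = UNIV" "distinct js"
    using finite_distinct_list[of "UNIV :: 'n set"] by auto
  define vs where "vs = map (\<lambda>i. \<epsilon> *\<^sub>R axis i 1 :: real^'n) js"
  have len: "length vs = CARD('n)"
    using js distinct_card[of js] by (simp add: vs_def)
  have norm_vs: "norm v \<le> \<epsilon>" if "v \<in> set vs" for v
    using that assms(2) by (auto simp: vs_def)
  \<comment> \<open>The error of averaging the divergence, and the contribution of each averaged partial derivative.\<close>
  have A: "ennreal \<bar>\<integral>x. (line_avgs vs D x - D x) * f x \<partial>lborel\<bar> \<le> ennreal (real CARD('n)) * \<W>"
    using pairing_line_avgs_le[OF assms(1) D, of 1 vs \<epsilon>] \<Phi>(2) norm_vs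
    by (simp add: len D_def \<W>_def ennreal_of_nat_eq_real_of_nat)
  have B: "ennreal \<bar>\<integral>x. line_avgs vs (g i) x * f x \<partial>lborel\<bar> \<le> \<W>" for i
  proof -
    have "\<epsilon> *\<^sub>R axis i 1 \<in> set vs"
      using js by (auto simp: vs_def)
    moreover have "Lp_norm (conj_exponent p) (\<phi> i) \<le> Lp_norm (conj_exponent p) \<Phi>"
      using assms(1)
      by (rule Lp_norm_mono)
        (auto simp: \<phi>_def component_le_norm_cart intro!: cont_compact_support_measurable
          test_functions_cont_compact_support \<phi>)
    ultimately have "ennreal \<bar>\<integral>x. line_avgs vs (dir_deriv (\<epsilon> *\<^sub>R axis i 1) (\<phi> i)) x * f x \<partial>lborel\<bar>
        \<le> \<W> * ennreal \<epsilon>"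
      unfolding \<W>_def using assms \<phi> \<Phi>(3) norm_vs
      by (intro pairing_line_avgs_dir_deriv_le) auto
    moreover have "dir_deriv (\<epsilon> *\<^sub>R axis i 1) (\<phi> i) = (\<lambda>x. \<epsilon> * g i x)"
      using dir_deriv_scaleR[OF \<phi>] by (auto simp: g_def)
    ultimately have "ennreal \<epsilon> * ennreal \<bar>\<integral>x. line_avgs vs (g i) x * f x \<partial>lborel\<bar> \<le> ennreal \<epsilon> * \<W>"
      using assms(2) by (simp add: line_avgs_cmult mult.assoc abs_mult ennreal_mult' mult.commute[of \<W>])
    then show ?thesis
      using assms(2) by (subst (asm) ennreal_mult_le_mult_iff) auto
  qed
  have gi: "integrable lborel (\<lambda>x. line_avgs vs (g i) x * f x)" for i
    by (intro integrable_mult[OF loc] line_avgs_cont_compact_support g)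
  have "(\<integral>x. D x * f x \<partial>lborel)
      = (\<integral>x. line_avgs vs D x * f x \<partial>lborel) - (\<integral>x. (line_avgs vs D x - D x) * f x \<partial>lborel)"
  proof -
    have "integrable lborel (\<lambda>x. line_avgs vs D x * f x)"
      "integrable lborel (\<lambda>x. (line_avgs vs D x - D x) * f x)"
      by (intro integrable_mult[OF loc] cont_compact_support_diff line_avgs_cont_compact_support D)+
    from Bochner_Integration.integral_diff[OF this] show ?thesis
      by (simp add: left_diff_distrib)
  qed
  also have "(\<integral>x. line_avgs vs D x * f x \<partial>lborel) = (\<Sum>i\<in>UNIV. \<integral>x. line_avgs vs (g i) x * f x \<partial>lborel)"
    unfolding D_def div by (simp add: line_avgs_sum g sum_distrib_right gi)
  finally have "\<bar>\<integral>x. D x * f x \<partial>lborel\<bar> \<le> (\<Sum>i\<in>UNIV. \<bar>\<integral>x. line_avgs vs (g i) x * f x \<partial>lborel\<bar>)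
      + \<bar>\<integral>x. (line_avgs vs D x - D x) * f x \<partial>lborel\<bar>"
    using sum_abs[of "\<lambda>i. \<integral>x. line_avgs vs (g i) x * f x \<partial>lborel" UNIV] by linarith
  then have "ennreal (\<integral>x. D x * f x \<partial>lborel)
      \<le> ennreal ((\<Sum>i\<in>UNIV. \<bar>\<integral>x. line_avgs vs (g i) x * f x \<partial>lborel\<bar>)
      + \<bar>\<integral>x. (line_avgs vs D x - D x) * f x \<partial>lborel\<bar>)"
    by (intro ennreal_leI) simp
  also have "\<dots> = (\<Sum>i\<in>UNIV. ennreal \<bar>\<integral>x. line_avgs vs (g i) x * f x \<partial>lborel\<bar>)
      + ennreal \<bar>\<integral>x. (line_avgs vs D x - D x) * f x \<partial>lborel\<bar>"
    by (simp add: sum_nonneg)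
  also have "\<dots> \<le> (\<Sum>i\<in>(UNIV::'n set). \<W>) + ennreal (real CARD('n)) * \<W>"
    by (intro add_mono sum_mono A B)
  also have "\<dots> = ennreal (2 * real CARD('n)) * \<W>"
    by (simp add: ennreal_of_nat_eq_real_of_nat flip: distrib_right ennreal_plus)
  finally show "ennreal (\<integral>x. divergence \<Phi> x * f x \<partial>lebesgue) \<le> ennreal (2 * real CARD('n)) * omega_p p f \<epsilon>"
    using integral_lebesgue_test[OF D] by (simp add: D_def \<W>_def)
qed

lemma omega_p_le_sigma_tilde_p:
  assumes "1 \<le> p" "0 < s"
  shows "omega_p p f s \<le> 2 * sigma_tilde_p p f (s / 2)"
  unfolding omega_p_def
proof (rule SUP_least, clarify)
  fix h :: "real^'n"
  assume h: "norm h \<le> s"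
  show "Lp_norm (ennreal p) (\<lambda>x. f (x - h) - f x) \<le> 2 * sigma_tilde_p p f (s / 2)"
  proof (cases "h = 0 \<or> sigma_tilde_p p f (s / 2) = top")
    case True
    moreover have "Lp_norm (ennreal p) (\<lambda>x. f (x - 0) - f x) = 0"
      using assms(1) by (simp add: Lp_norm_ennreal epowr_def)
    ultimately show ?thesis by (auto simp: ennreal_mult_top)
  next
    case False
    then obtain \<sigma> where \<sigma>: "0 \<le> \<sigma>" "sigma_tilde_p p f (s / 2) = ennreal \<sigma>"
      by (cases "sigma_tilde_p p f (s / 2)") auto
    have "Lp_norm (ennreal p) (\<lambda>x. f (x - h) - f x) \<le> ennreal (2 * \<sigma>)"
    proof (rule Lp_norm_le_dual)
      fix \<psi> :: "real^'n \<Rightarrow> real"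
      assume \<psi>: "\<psi> \<in> test_functions" "Lp_norm (conj_exponent p) \<psi> \<le> 1"
      have \<psi>_cc: "\<psi> \<in> cont_compact_support"
        using \<psi>(1) by (rule test_functions_cont_compact_support)
      define e where "e = h /\<^sub>R norm h"
      have e: "norm e = 1" "norm h *\<^sub>R e = h"
        using False by (auto simp: e_def)
      \<comment> \<open>The constant makes \<^term>\<open>dir_deriv e \<phi>\<close> half the difference of \<open>\<psi>\<close>, so its norm is at most 1.\<close>
      define \<phi> where "\<phi> x = norm h / 2 * line_avg h \<psi> x" for x
      have \<phi>: "\<phi> \<in> test_functions"
        unfolding \<phi>_def by (intro test_functions_cmult line_avg_test_functions \<psi>(1))
      have "dir_deriv e \<phi> x = norm h / 2 * dir_deriv e (line_avg h \<psi>) x" for x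
        unfolding \<phi>_def
        by (rule dir_deriv_bounded_linear[OF bounded_linear_mult_right
              line_avg_test_functions[OF \<psi>(1)]])
      then have "dir_deriv e \<phi> x = 1 / 2 * dir_deriv (norm h *\<^sub>R e) (line_avg h \<psi>) x" for x
        by (simp add: dir_deriv_scaleR line_avg_test_functions \<psi>(1))
      then have deriv: "dir_deriv e \<phi> = (\<lambda>x. (\<psi> (x + h) - \<psi> x) / 2)"
        using \<psi>(1) by (auto simp: e dir_deriv_line_avg line_avg_dir_deriv)
      have n1: "Lp_norm (conj_exponent p) (dir_deriv e \<phi>) \<le> 1"
        unfolding deriv using Lp_norm_half_difference_le[OF assms(1) \<psi>_cc, of 1 h] \<psi>(2) by simp
      have "Lp_norm (conj_exponent p) \<phi> \<le> ennreal (norm h / 2 * 1)"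
        unfolding \<phi>_def using assms(1) \<psi>(2) \<psi>_cc
        by (intro Lp_norm_cmult_le Lp_norm_line_avg_le line_avg_cont_compact_support) auto
      also have "\<dots> \<le> ennreal (s / 2)"
        using h by (intro ennreal_leI) simp
      finally have n2: "Lp_norm (conj_exponent p) \<phi> \<le> ennreal (s / 2)" .
      have "ennreal (\<integral>x. dir_deriv e \<phi> x * f x \<partial>lebesgue) \<le> sigma_tilde_p p f (s / 2)"
        unfolding sigma_tilde_p_def using e(1) \<phi> n1 n2 by (intro SUP_upper2[of "(e, \<phi>)"]) auto
      then have "(\<integral>x. dir_deriv e \<phi> x * f x \<partial>lebesgue) \<le> \<sigma>"
        using \<sigma> by (simp add: ennreal_le_iff)
      then have "(\<integral>x. dir_deriv e \<phi> x * f x \<partial>lborel) \<le> \<sigma>"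
        using \<phi> by (simp add: integral_lebesgue_test test_functions_cont_compact_support
            dir_deriv_test_functions)
      moreover have "(\<integral>x. dir_deriv e \<phi> x * f x \<partial>lborel) = (\<integral>x. (\<psi> (x + h) - \<psi> x) * f x \<partial>lborel) / 2"
        unfolding deriv by simp
      ultimately show "(\<integral>x. \<psi> x * (f (x - h) - f x) \<partial>lborel) \<le> 2 * \<sigma>"
        using integral_difference_mult[OF loc \<psi>_cc, of h] by (simp add: mult.commute)
    qed (use assms \<sigma> locally_integrable_difference[OF loc] in auto)
    then show ?thesis
      using \<sigma> by (simp add: ennreal_mult')
  qed
qed

end

lemma divergence_scaleR_const:
  fixes \<phi> :: "real^'n \<Rightarrow> real"
  assumes "\<phi> \<in> test_functions"
  shows "divergence (\<lambda>x. \<phi> x *\<^sub>R e) = dir_deriv e \<phi>"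
proof
  fix x
  have "divergence (\<lambda>x. \<phi> x *\<^sub>R e) x = (\<Sum>i\<in>UNIV. dir_deriv (axis i 1) \<phi> x * e $ i)"
    using dir_deriv_bounded_linear[OF bounded_linear_mult_left assms] by (simp add: divergence_def)
  also have "\<dots> = (\<Sum>i\<in>UNIV. dir_deriv (e $ i *\<^sub>R axis i 1) \<phi> x)"
    by (simp add: dir_deriv_scaleR[OF assms] mult.commute)
  also have "\<dots> = dir_deriv (\<Sum>i\<in>UNIV. e $ i *\<^sub>R axis i 1) \<phi> x"
    by (rule linear_sum[OF has_derivative_linear[OF test_functions_has_derivative[OF assms]], symmetric])
  also have "(\<Sum>i\<in>UNIV. e $ i *\<^sub>R axis i 1) = e"
    using basis_expansion[of e] by (simp add: scalar_mult_eq_scaleR)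
  finally show "divergence (\<lambda>x. \<phi> x *\<^sub>R e) x = dir_deriv e \<phi> x" .
qed

lemma sigma_tilde_p_le_sigma_p:
  fixes f :: "real^'n \<Rightarrow> real"
  shows "sigma_tilde_p p f \<epsilon> \<le> sigma_p p f \<epsilon>"
  unfolding sigma_tilde_p_def
proof (rule SUP_least, clarify)
  fix e :: "real^'n" and \<phi> :: "real^'n \<Rightarrow> real"
  assume *: "norm e = 1" "\<phi> \<in> test_functions"
    "Lp_norm (conj_exponent p) (dir_deriv e \<phi>) \<le> 1" "Lp_norm (conj_exponent p) \<phi> \<le> ennreal \<epsilon>"
  have "(\<lambda>x. \<phi> x *\<^sub>R e) \<in> test_functions"
    by (rule test_functions_bounded_linear[OF bounded_linear_scaleR_left *(2)])
  moreover have "Lp_norm q (\<lambda>x. \<phi> x *\<^sub>R e) = Lp_norm q \<phi>" for q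
    using *(1) by (simp add: Lp_norm_def)
  ultimately show "ennreal (\<integral>x. dir_deriv e \<phi> x * f x \<partial>lebesgue) \<le> sigma_p p f \<epsilon>"
    unfolding sigma_p_def using *
    by (intro SUP_upper2[of "\<lambda>x. \<phi> x *\<^sub>R e"]) (auto simp: divergence_scaleR_const)
qed

section \<open>Weighted norms of monotone functions\<close>

lemma mono_omega_p: "mono (omega_p p f)"
  unfolding omega_p_def by (intro monoI SUP_subset_mono) auto

lemma mono_sigma_tilde_p: "mono (sigma_tilde_p p f)"
  unfolding sigma_tilde_p_def
  by (intro monoI SUP_subset_mono) (auto intro: order_trans ennreal_leI)

lemma borel_measurable_mono_ennreal:
  fixes g :: "real \<Rightarrow> ennreal"
  assumes "mono g"
  shows "g \<in> borel_measurable borel"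
proof (rule borel_measurableI_greater)
  fix y
  have "is_interval {x. y < g x}"
    unfolding is_interval_1 using assms by (auto dest: monoD intro: less_le_trans)
  then show "{x \<in> space borel. y < g x} \<in> sets borel"
    by (simp add: real_interval_borel_measurable)
qed

lemma measurable_epowr [measurable]: "(\<lambda>x. epowr x a) \<in> borel_measurable borel"
  unfolding epowr_def by measurable

lemma weighted_norm_finite_exponent:
  assumes "\<theta> \<noteq> top"
  shows "weighted_norm \<alpha> \<theta> g = epowr (\<integral>\<^sup>+s. epowr (ennreal (s powr (-\<alpha>)) * g s) (enn2real \<theta>)
    * ennreal (1 / s) * indicator {0<..} s \<partial>lborel) (1 / enn2real \<theta>)"
  using assms by (simp add: weighted_norm_def nn_integral_completion)

lemma enn2real_ge_1:
  assumes "1 \<le> \<theta>" "\<theta> \<noteq> top"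
  shows "1 \<le> enn2real \<theta>"
  using enn2real_mono[of 1 \<theta>] assms by (simp add: less_top)

text \<open>Monotonicity of \<open>g\<close> is needed for measurability only; \<open>u\<close> may be arbitrary.\<close>

lemma weighted_norm_mono_mult:
  assumes "1 \<le> \<theta>" "0 < c" "mono g" "\<And>s. 0 < s \<Longrightarrow> u s \<le> ennreal c * g s"
  shows "weighted_norm \<alpha> \<theta> u \<le> ennreal c * weighted_norm \<alpha> \<theta> g"
proof (cases "\<theta> = top")
  case True
  have "ennreal (s powr (-\<alpha>)) * u s \<le> ennreal c * (SUP s\<in>{0<..}. ennreal (s powr (-\<alpha>)) * g s)"
    if "0 < s" for s
  proof -
    have "ennreal (s powr (-\<alpha>)) * u s \<le> ennreal (s powr (-\<alpha>)) * (ennreal c * g s)"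
      by (intro mult_left_mono assms(4) that) simp
    also have "\<dots> = ennreal c * (ennreal (s powr (-\<alpha>)) * g s)"
      by (simp add: mult_ac)
    also have "\<dots> \<le> ennreal c * (SUP s\<in>{0<..}. ennreal (s powr (-\<alpha>)) * g s)"
      using that by (intro mult_left_mono SUP_upper) auto
    finally show ?thesis .
  qed
  then show ?thesis
    using True by (auto simp: weighted_norm_def intro!: SUP_least)
next
  case False
  define t where "t = enn2real \<theta>"
  have t: "1 \<le> t" unfolding t_def using assms(1) False by (rule enn2real_ge_1)
  have [measurable]: "g \<in> borel_measurable borel"
    using assms(3) by (rule borel_measurable_mono_ennreal)
  define k where "k v s = epowr (ennreal (s powr (-\<alpha>)) * v s) t * ennreal (1 / s) * indicator {0<..} s"
    for v :: "real \<Rightarrow> ennreal" and s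
  have [measurable]: "k g \<in> borel_measurable borel"
    unfolding k_def by measurable
  have "k u s \<le> ennreal (c powr t) * k g s" for s
  proof (cases "0 < s")
    case True
    have "epowr (ennreal (s powr (-\<alpha>)) * u s) t \<le> epowr (ennreal (s powr (-\<alpha>)) * (ennreal c * g s)) t"
      using t True by (intro epowr_mono mult_left_mono assms(4)) auto
    also have "\<dots> = epowr (ennreal c * (ennreal (s powr (-\<alpha>)) * g s)) t"
      by (simp add: mult_ac)
    also have "\<dots> = ennreal (c powr t) * epowr (ennreal (s powr (-\<alpha>)) * g s) t"
      using assms(2) by (rule epowr_mult)
    finally show ?thesis
      using True unfolding k_def by (simp add: mult_right_mono mult.assoc[symmetric])
  qed (simp add: k_def)
  then have "(\<integral>\<^sup>+s. k u s \<partial>lborel) \<le> (\<integral>\<^sup>+s. ennreal (c powr t) * k g s \<partial>lborel)"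
    by (intro nn_integral_mono)
  also have "\<dots> = ennreal (c powr t) * (\<integral>\<^sup>+s. k g s \<partial>lborel)"
    by (rule nn_integral_cmult) simp
  finally have "epowr (\<integral>\<^sup>+s. k u s \<partial>lborel) (1 / t)
      \<le> epowr (ennreal (c powr t) * (\<integral>\<^sup>+s. k g s \<partial>lborel)) (1 / t)"
    using t by (intro epowr_mono) auto
  also have "\<dots> = ennreal c * epowr (\<integral>\<^sup>+s. k g s \<partial>lborel) (1 / t)"
    using t assms(2) by (simp add: epowr_mult powr_powr)
  finally show ?thesis
    using False by (simp add: weighted_norm_finite_exponent k_def t_def)
qed

lemma weighted_norm_half_scale_le:
  assumes "1 \<le> \<theta>" "mono g"
  shows "weighted_norm \<alpha> \<theta> (\<lambda>s. g (s / 2)) \<le> ennreal (2 powr (-\<alpha>)) * weighted_norm \<alpha> \<theta> g"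
proof (cases "\<theta> = top")
  case True
  have "ennreal (s powr (-\<alpha>)) * g (s / 2)
      \<le> ennreal (2 powr (-\<alpha>)) * (SUP s\<in>{0<..}. ennreal (s powr (-\<alpha>)) * g s)" if "0 < s" for s
  proof -
    have "s powr (-\<alpha>) = 2 powr (-\<alpha>) * (s / 2) powr (-\<alpha>)"
      using that by (simp flip: powr_mult)
    then have "ennreal (s powr (-\<alpha>)) * g (s / 2)
        = ennreal (2 powr (-\<alpha>)) * (ennreal ((s / 2) powr (-\<alpha>)) * g (s / 2))"
      by (simp add: ennreal_mult' mult_ac)
    also have "\<dots> \<le> ennreal (2 powr (-\<alpha>)) * (SUP s\<in>{0<..}. ennreal (s powr (-\<alpha>)) * g s)"
      using that by (intro mult_left_mono SUP_upper2[of "s / 2"]) auto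
    finally show ?thesis .
  qed
  then show ?thesis
    using True by (auto simp: weighted_norm_def intro!: SUP_least)
next
  case False
  define t where "t = enn2real \<theta>"
  have t: "1 \<le> t" unfolding t_def using assms(1) False by (rule enn2real_ge_1)
  have [measurable]: "g \<in> borel_measurable borel"
    using assms(2) by (rule borel_measurable_mono_ennreal)
  define k where "k v s = epowr (ennreal (s powr (-\<alpha>)) * v s) t * ennreal (1 / s) * indicator {0<..} s"
    for v :: "real \<Rightarrow> ennreal" and s
  have [measurable]: "k g \<in> borel_measurable borel" "k (\<lambda>s. g (s / 2)) \<in> borel_measurable borel"
    unfolding k_def by measurable
  have pointwise: "2 * k (\<lambda>s. g (s / 2)) (2 * s) = ennreal (2 powr (-\<alpha> * t)) * k g s" for s
  proof (cases "0 < s")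
    case True
    have "ennreal ((2 * s) powr (-\<alpha>)) * g s = ennreal (2 powr (-\<alpha>)) * (ennreal (s powr (-\<alpha>)) * g s)"
      using True by (simp add: powr_mult ennreal_mult' mult.assoc)
    then have "epowr (ennreal ((2 * s) powr (-\<alpha>)) * g s) t
        = ennreal (2 powr (-\<alpha> * t)) * epowr (ennreal (s powr (-\<alpha>)) * g s) t"
      by (simp add: epowr_mult powr_powr)
    moreover have "2 * ennreal (1 / (2 * s)) = ennreal (1 / s)"
      using True by (subst ennreal_numeral[symmetric], subst ennreal_mult[symmetric]) auto
    ultimately show ?thesis
      using True unfolding k_def by (simp add: mult.assoc mult.left_commute[of 2])
  qed (simp add: k_def)
  have "(\<integral>\<^sup>+s. k (\<lambda>s. g (s / 2)) s \<partial>lborel) = 2 * (\<integral>\<^sup>+s. k (\<lambda>s. g (s / 2)) (2 * s) \<partial>lborel)"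
    using nn_integral_real_affine[of "k (\<lambda>s. g (s / 2))" 2 0] by simp
  also have "\<dots> = (\<integral>\<^sup>+s. ennreal (2 powr (-\<alpha> * t)) * k g s \<partial>lborel)"
    by (subst nn_integral_cmult[symmetric]) (simp_all add: pointwise)
  also have "\<dots> = ennreal (2 powr (-\<alpha> * t)) * (\<integral>\<^sup>+s. k g s \<partial>lborel)"
    by (rule nn_integral_cmult) simp
  finally have "epowr (\<integral>\<^sup>+s. k (\<lambda>s. g (s / 2)) s \<partial>lborel) (1 / t)
      = ennreal (2 powr (-\<alpha>)) * epowr (\<integral>\<^sup>+s. k g s \<partial>lborel) (1 / t)"
    using t by (simp add: epowr_mult powr_powr)
  then show ?thesis
    using False by (simp add: weighted_norm_finite_exponent k_def t_def)
qed

section \<open>Passage to Borel representatives\<close>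

lemma AE_lborel_translate:
  fixes v :: "'a::euclidean_space"
  assumes "AE x in lborel. P x"
  shows "AE x in lborel. P (x - v)"
proof -
  obtain N where N: "{x. \<not> P x} \<subseteq> N" "N \<in> null_sets lborel"
    using assms by (auto simp: eventually_ae_filter)
  show ?thesis
    by (rule AE_I'[OF null_sets_translation[OF N(2), of v]]) (use N(1) in auto)
qed

lemma Lp_norm_cong_AE:
  assumes "1 \<le> p" "AE x in lborel. f x = g x"
  shows "Lp_norm (ennreal p) f = Lp_norm (ennreal p) g"
proof -
  have "(\<integral>\<^sup>+x. ennreal (norm (f x) powr p) \<partial>lborel) = (\<integral>\<^sup>+x. ennreal (norm (g x) powr p) \<partial>lborel)"
    by (rule nn_integral_cong_AE) (use assms(2) in eventually_elim, simp)
  then show ?thesis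
    using assms(1) by (simp add: Lp_norm_ennreal)
qed

lemma omega_p_cong_AE:
  assumes "1 \<le> p" "AE x in lborel. f x = g x"
  shows "omega_p p f = omega_p p g"
proof -
  have "Lp_norm (ennreal p) (\<lambda>x. f (x - h) - f x) = Lp_norm (ennreal p) (\<lambda>x. g (x - h) - g x)" for h
  proof (rule Lp_norm_cong_AE[OF assms(1)])
    show "AE x in lborel. f (x - h) - f x = g (x - h) - g x"
      using assms(2) AE_lborel_translate[OF assms(2), of h] by eventually_elim simp
  qed
  then show ?thesis
    by (intro ext) (simp add: omega_p_def)
qed

lemma integral_lebesgue_mult_cong_AE:
  fixes f g \<phi> :: "'a::euclidean_space \<Rightarrow> real"
  assumes "AE x in lborel. f x = g x" "f \<in> borel_measurable lebesgue" "g \<in> borel_measurable lebesgue"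
    and "\<phi> \<in> cont_compact_support"
  shows "(\<integral>x. \<phi> x * f x \<partial>lebesgue) = (\<integral>x. \<phi> x * g x \<partial>lebesgue)"
proof -
  have [measurable]: "\<phi> \<in> borel_measurable lebesgue"
    using cont_compact_support_measurable[OF assms(4)] by (simp add: measurable_completion)
  note assms(2,3) [measurable]
  show ?thesis
    using AE_completion[OF assms(1)] by (intro integral_cong_AE) (auto elim: eventually_mono)
qed

lemma sigma_p_cong_AE:
  fixes f g :: "real^'n \<Rightarrow> real"
  assumes "AE x in lborel. f x = g x" "f \<in> borel_measurable lebesgue" "g \<in> borel_measurable lebesgue"
  shows "sigma_p p f = sigma_p p g"
  unfolding sigma_p_def
  by (intro ext SUP_cong refl)
    (auto simp: integral_lebesgue_mult_cong_AE[OF assms] divergence_cont_compact_support)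

lemma sigma_tilde_p_cong_AE:
  fixes f g :: "real^'n \<Rightarrow> real"
  assumes "AE x in lborel. f x = g x" "f \<in> borel_measurable lebesgue" "g \<in> borel_measurable lebesgue"
  shows "sigma_tilde_p p f = sigma_tilde_p p g"
  unfolding sigma_tilde_p_def
  by (intro ext SUP_cong refl)
    (auto simp: integral_lebesgue_mult_cong_AE[OF assms] dir_deriv_test_functions
      test_functions_cont_compact_support)

text \<open>The three moduli depend on \<open>f\<close> only up to null sets, so a Lebesgue measurable \<open>f\<close> can be
  replaced by a Borel measurable function that agrees with it almost everywhere.\<close>

lemma Lp_space_borel_representative:
  fixes f :: "real^'n \<Rightarrow> real"
  assumes "1 \<le> p" "f \<in> Lp_space (ennreal p)"
  obtains f' :: "real^'n \<Rightarrow> real" where "locally_integrable f'" "omega_p p f = omega_p p f'"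
    "sigma_p p f = sigma_p p f'" "sigma_tilde_p p f = sigma_tilde_p p f'"
proof -
  have f: "f \<in> borel_measurable lebesgue" "Lp_norm (ennreal p) f < top"
    using assms(2) by (auto simp: Lp_space_def)
  obtain f' where f': "f' \<in> borel_measurable lborel" "AE x in lborel. f x = f' x"
    using completion_ex_borel_measurable_real[OF f(1)] by blast
  have "f' \<in> borel_measurable lebesgue"
    using f'(1) by (rule measurable_completion)
  moreover have "Lp_norm (ennreal p) f' < top"
    using f(2) Lp_norm_cong_AE[OF assms(1) f'(2)] by simp
  then have "locally_integrable f'"
    using f'(1) assms(1) by (intro Lp_imp_locally_integrable) auto
  ultimately show thesis
    using that omega_p_cong_AE[OF assms(1) f'(2)] sigma_p_cong_AE[OF f'(2) f(1)]
      sigma_tilde_p_cong_AE[OF f'(2) f(1)] by blast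
qed

theorem corollary2p10:
  fixes f :: "real^'n \<Rightarrow> real" and p \<alpha> :: real and \<theta> :: ennreal
  assumes "1 \<le> p" and "1 \<le> \<theta>" and "0 < \<alpha>" and "\<alpha> < 1"
    and "f \<in> Lp_space (ennreal p)"
  shows "(f \<in> besov_class \<alpha> p \<theta> \<longleftrightarrow> V_functional p \<theta> \<alpha> f < top)
    \<and> (V_functional p \<theta> \<alpha> f < top \<longleftrightarrow> V_tilde_functional p \<theta> \<alpha> f < top)
    \<and> ennreal (2 powr (\<alpha> - 1)) * besov_seminorm \<alpha> p \<theta> f \<le> V_tilde_functional p \<theta> \<alpha> f
    \<and> V_tilde_functional p \<theta> \<alpha> f \<le> V_functional p \<theta> \<alpha> f
    \<and> V_functional p \<theta> \<alpha> f
        \<le> ennreal (2 * (1 + sqrt (real CARD('n)) + real CARD('n))) * besov_seminorm \<alpha> p \<theta> f"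
proof -
  obtain f' :: "real^'n \<Rightarrow> real" where f': "locally_integrable f'" and eq: "omega_p p f = omega_p p f'"
    "sigma_p p f = sigma_p p f'" "sigma_tilde_p p f = sigma_tilde_p p f'"
    using Lp_space_borel_representative[OF assms(1,5)] by blast
  define C where "C = 2 * (1 + sqrt (real CARD('n)) + real CARD('n))"
  have C: "0 < C" "2 * real CARD('n) \<le> C"
    by (auto simp: C_def add_pos_nonneg)
  define N V W where "N = besov_seminorm \<alpha> p \<theta> f" and "V = V_functional p \<theta> \<alpha> f"
    and "W = V_tilde_functional p \<theta> \<alpha> f"
  note defs = N_def V_def W_def besov_seminorm_def V_functional_def V_tilde_functional_def eq
  have upper: "V \<le> ennreal C * N"
    unfolding defs
  proof (rule weighted_norm_mono_mult[OF assms(2) C(1) mono_omega_p])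
    fix s :: real assume "0 < s"
    with assms(1) have "sigma_p p f' s \<le> ennreal (2 * real CARD('n)) * omega_p p f' s"
      by (rule sigma_p_le_omega_p[OF f'])
    also have "\<dots> \<le> ennreal C * omega_p p f' s"
      using C by (intro mult_right_mono ennreal_leI) auto
    finally show "sigma_p p f' s \<le> ennreal C * omega_p p f' s" .
  qed
  have "0 < enn2real \<theta>" if "\<theta> \<noteq> top"
    using enn2real_ge_1[OF assms(2) that] by simp
  then have middle: "W \<le> V"
    unfolding defs weighted_norm_def
    by (auto intro!: SUP_mono' epowr_mono nn_integral_mono mult_right_mono mult_left_mono
        sigma_tilde_p_le_sigma_p)
  have "N \<le> ennreal 2 * weighted_norm \<alpha> \<theta> (\<lambda>s. sigma_tilde_p p f' (s / 2))"
    unfolding defs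
  proof (rule weighted_norm_mono_mult[OF assms(2)])
    show "mono (\<lambda>s. sigma_tilde_p p f' (s / 2))"
      using mono_sigma_tilde_p[of p f'] by (auto simp: mono_def)
  qed (use omega_p_le_sigma_tilde_p[OF f' assms(1)] in auto)
  also have "\<dots> \<le> ennreal 2 * (ennreal (2 powr (-\<alpha>)) * W)"
    unfolding defs
    by (intro mult_left_mono weighted_norm_half_scale_le assms(2) mono_sigma_tilde_p) simp
  finally have "ennreal (2 powr (\<alpha> - 1)) * N
      \<le> ennreal (2 powr (\<alpha> - 1)) * (ennreal 2 * (ennreal (2 powr (-\<alpha>)) * W))"
    by (rule mult_left_mono) simp
  also have "\<dots> = ennreal (2 powr (\<alpha> - 1) * (2 * 2 powr (-\<alpha>))) * W"
    by (simp only: ennreal_mult powr_ge_zero mult.assoc zero_le_numeral mult_nonneg_nonneg)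
  also have "2 powr (\<alpha> - 1) * (2 * 2 powr (-\<alpha>)) = (1::real)"
    by (simp add: powr_diff powr_minus)
  finally have lower: "ennreal (2 powr (\<alpha> - 1)) * N \<le> W" by simp
  have "f \<in> besov_class \<alpha> p \<theta> \<longleftrightarrow> N < top"
    using assms(5) by (simp add: besov_class_def N_def)
  moreover have "V < top" if "N < top"
    using le_less_trans[OF upper] that by (simp add: ennreal_mult_less_top)
  moreover have "W < top" if "V < top"
    using middle that by (rule le_less_trans)
  moreover have "N < top" if "W < top"
    using le_less_trans[OF lower that] by (auto simp: ennreal_mult_less_top)
  ultimately show ?thesis
    using lower middle upper unfolding N_def V_def W_def C_def by blast
qed

end
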